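(* Let $f:[0,1]\to[0,1]$ be a piecewise $C^1$ Markov map with the specification property, with finitely many (possibly no) parabolic fixed points $x_i$, i.e. points with $f(x_i)=x_i$ and $f'(x_i)=1$, and with $f'(x)>1$ for all $x\in[0,1]\setminus\bigcup_i\{x_i\}$. Let $\psi=\log f'$, let $\varphi:[0,1]\to\mathbb{R}$ be continuous, and let $\alpha\in\mathbb{R}$ be such that $$X(\varphi,\alpha)=\left\{x\in[0,1]:\lim_{n\to\infty}\frac1n\sum_{i=0}^{n-1}\varphi(f^i(x))=\alpha\right\}$$ is non-empty. Suppose that the function $s\mapsto P_{X(\varphi,\alpha)}(-s\psi)$ has a unique zero $d$, and that $$\dim_H(X(\varphi,\alpha))=\sup\left\{\frac{h_\mu}{\int\log f'\,d\mu}:\ \mu\in\mathcal{M}_f([0,1]),\ \int\varphi\,d\mu=\alpha\right\}.$$ Then $d=\dim_H(X(\varphi,\alpha))$.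
   Context: Piecewise $C^1$ Markov map: there is a partition $0=a_0<a_1<\dots<a_m=1$ such that $f$ restricted to each $(a_{i-1},a_i)$ is strictly increasing and extends to a $C^1$ map on $[a_{i-1},a_i]$, and the closure of $f((a_{i-1},a_i))$ is a union of intervals $[a_{j-1},a_j]$; at partition points $f$ and $f'$ take the values given by one of the adjacent branches (one-sided derivative). $\mathcal{M}_f([0,1])$ is the set of $f$-invariant Borel probability measures, $h_\mu$ is measure-theoretic entropy with respect to $f$, $\dim_H$ is Hausdorff dimension. In the displayed supremum only measures for which the ratio is defined (those with $\int\log f'\,d\mu>0$) are considered. In what follows $X=[0,1]$ and $d(\cdot,\cdot)$ is the usual distance. Specification property: for all $\epsilon>0$ there exists an integer $m=m(\epsilon)$ such that for any collection $\{[a_j,b_j]\subset\mathbb{N}: j=1,\dots,k\}$ of finite intervals of integers with $a_{j+1}-b_j\ge m(\epsilon)$ for $j=1,\dots,k-1$ and any $x_1,\dots,x_k\in X$, there exists $x\in X$ such that $d(f^{p+a_j}x,f^px_j)<\epsilon$ for all $p=0,\dots,b_j-a_j$ and every $j=1,\dots,k$. Topological pressure (Pesin–Pitskel): for $\epsilon>0$, $n\in\mathbb{N}$, $x\in X$ let $B_n(x,\epsilon)=\{y\in X: d(f^i(x),f^i(y))<\epsilon\text{ for all }i=0,\dots,n-1\}$. For a Borel set $Z\subset X$, a function $\theta:X\to\mathbb{R}$ (here $\theta=-s\psi$), $r\in\mathbb{R}$ and a finite or countable collection $\Gamma=\{B_{n_i}(x_i,\epsilon)\}_i$ put $$Q(Z,r,\Gamma,\theta)=\sum_{B_{n_i}(x_i,\epsilon)\in\Gamma}\exp\left(-r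 n_i+\sup_{x\in B_{n_i}(x_i,\epsilon)}\sum_{k=0}^{n_i-1}\theta(f^k(x))\right),$$ and $M(Z,r,\epsilon,N,\theta)=\inf_\Gamma Q(Z,r,\Gamma,\theta)$, where the infimum is over all finite or countable collections $\Gamma=\{B_{n_i}(x_i,\epsilon)\}_i$ with $x_i\in X$ which cover $Z$ and have $n_i\ge N$ for all $i$. Let $m(Z,r,\epsilon,\theta)=\lim_{N\to\infty}M(Z,r,\epsilon,N,\theta)$, $P_Z(\theta,\epsilon)=\inf\{r: m(Z,r,\epsilon,\theta)=0\}=\sup\{r: m(Z,r,\epsilon,\theta)=\infty\}$, and $P_Z(\theta)=\lim_{\epsilon\to0}P_Z(\theta,\epsilon)$. *)

theory Defs
  imports "HOL-Probability.Probability"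
begin

(* Df is part of the data: if f is continuous at a partition point but has a corner there, f alone
   does not determine which one-sided derivative is used. The functions g i, g' i are the C^1
   extension of the i-th branch to the closed interval and its derivative; at a partition point
   f and Df take their values from the same adjacent branch. *)
definition piecewise_C1_Markov :: "(real \<Rightarrow> real) \<Rightarrow> (real \<Rightarrow> real) \<Rightarrow> bool" where
  "piecewise_C1_Markov f Df \<longleftrightarrow>
    (\<exists>(m::nat) (a :: nat \<Rightarrow> real) (g :: nat \<Rightarrow> real \<Rightarrow> real) (g' :: nat \<Rightarrow> real \<Rightarrow> real).
      0 < m \<and> a 0 = 0 \<and> a m = 1 \<and> (\<forall>i<m. a i < a (Suc i)) \<and>
      (\<forall>i<m.
        strict_mono_on {a i<..<a (Suc i)} f \<and>
        (\<forall>x\<in>{a i..a (Suc i)}. (g i has_real_derivative g' i x) (at x within {a i..a (Suc i)})) \<and>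
        continuous_on {a i..a (Suc i)} (g' i) \<and>
        (\<forall>x\<in>{a i<..<a (Suc i)}. f x = g i x \<and> Df x = g' i x) \<and>
        (\<exists>J\<subseteq>{..<m}. closure (f ` {a i<..<a (Suc i)}) = (\<Union>j\<in>J. {a j..a (Suc j)}))) \<and>
      (\<forall>k\<le>m. \<exists>i<m. (k = i \<or> k = Suc i) \<and> f (a k) = g i (a k) \<and> Df (a k) = g' i (a k)))"

definition specification_property :: "'a::metric_space set \<Rightarrow> ('a \<Rightarrow> 'a) \<Rightarrow> bool" where
  "specification_property X f \<longleftrightarrow>
    (\<forall>\<epsilon>>0. \<exists>m::nat. \<forall>(k::nat) (a :: nat \<Rightarrow> nat) (b :: nat \<Rightarrow> nat) (x :: nat \<Rightarrow> 'a).
      (\<forall>j\<in>{1..k}. a j \<le> b j \<and> x j \<in> X) \<longrightarrow>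
      (\<forall>j\<in>{1..<k}. b j + m \<le> a (j + 1)) \<longrightarrow>
      (\<exists>y\<in>X. \<forall>j\<in>{1..k}. \<forall>p\<le>b j - a j.
         dist ((f ^^ (p + a j)) y) ((f ^^ p) (x j)) < \<epsilon>))"

definition birkhoff_level_set :: "'a set \<Rightarrow> ('a \<Rightarrow> 'a) \<Rightarrow> ('a \<Rightarrow> real) \<Rightarrow> real \<Rightarrow> 'a set" where
  "birkhoff_level_set X f \<phi> \<alpha> =
    {x\<in>X. (\<lambda>n. (1 / real n) * (\<Sum>i<n. \<phi> ((f ^^ i) x))) \<longlonglongrightarrow> \<alpha>}"

definition invariant_prob_measures ::
    "'a::topological_space set \<Rightarrow> ('a \<Rightarrow> 'a) \<Rightarrow> 'a measure set" where
  "invariant_prob_measures X f =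
    {\<mu>. prob_space \<mu> \<and> sets \<mu> = sets (restrict_space borel X) \<and>
         f \<in> measurable \<mu> \<mu> \<and> distr \<mu> \<mu> f = \<mu>}"

definition iterated_join :: "'a measure \<Rightarrow> ('a \<Rightarrow> 'a) \<Rightarrow> 'a set set \<Rightarrow> nat \<Rightarrow> 'a set set" where
  "iterated_join \<mu> f \<xi> n =
    {{x \<in> space \<mu>. \<forall>i<n. (f ^^ i) x \<in> A i} | A. \<forall>i<n. A i \<in> \<xi>}"

definition partition_entropy :: "'a measure \<Rightarrow> 'a set set \<Rightarrow> real" where
  "partition_entropy \<mu> \<xi> = - (\<Sum>A\<in>\<xi>. measure \<mu> A * ln (measure \<mu> A))"

(* Kolmogorov-Sinai entropy; the limit exists for invariant probability measures, by subadditivity.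
   Joins may contain the empty set as an element, which contributes 0 to the entropy. *)
definition measure_entropy :: "'a measure \<Rightarrow> ('a \<Rightarrow> 'a) \<Rightarrow> ereal" where
  "measure_entropy \<mu> f =
    (SUP \<xi> \<in> {\<xi>. finite \<xi> \<and> \<xi> \<subseteq> sets \<mu> \<and> partition_on (space \<mu>) \<xi>}.
       ereal (lim (\<lambda>n. (1 / real n) * partition_entropy \<mu> (iterated_join \<mu> f \<xi> n))))"

(* Only meaningful for s > 0, because 0 powr 0 = 0. Finite covers are obtained by taking almost all
   U i empty. Boundedness is required since the diameter of an unbounded set is unspecified. *)
definition hausdorff_premeasure :: "real \<Rightarrow> real \<Rightarrow> 'a::metric_space set \<Rightarrow> ennreal" where
  "hausdorff_premeasure s \<delta> Z =
    (INF U \<in> {U :: nat \<Rightarrow> 'a set. Z \<subseteq> (\<Union>i. U i) \<and> (\<forall>i. bounded (U i) \<and> diameter (U i) \<le> \<delta>)}.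
       (\<Sum>i. ennreal (diameter (U i) powr s)))"

definition hausdorff_measure :: "real \<Rightarrow> 'a::metric_space set \<Rightarrow> ennreal" where
  "hausdorff_measure s Z = (SUP \<delta>\<in>{0<..}. hausdorff_premeasure s \<delta> Z)"

definition hausdorff_dim :: "'a::metric_space set \<Rightarrow> ereal" where
  "hausdorff_dim Z = Inf {ereal s | s. 0 < s \<and> hausdorff_measure s Z = 0}"

definition bowen_ball :: "'a::metric_space set \<Rightarrow> ('a \<Rightarrow> 'a) \<Rightarrow> nat \<Rightarrow> 'a \<Rightarrow> real \<Rightarrow> 'a set" where
  "bowen_ball X f n x \<epsilon> = {y\<in>X. \<forall>i<n. dist ((f ^^ i) x) ((f ^^ i) y) < \<epsilon>}"

(* A collection of Bowen balls of radius \<epsilon> is encoded by the set of its (centre, length) pairs.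
   The supremum is a real one, so \<theta> is meant to be bounded above on X. *)
definition pressure_sum ::
    "'a::metric_space set \<Rightarrow> ('a \<Rightarrow> 'a) \<Rightarrow> ('a \<Rightarrow> real) \<Rightarrow> real \<Rightarrow> real \<Rightarrow> ('a \<times> nat) set \<Rightarrow> ennreal" where
  "pressure_sum X f \<theta> \<epsilon> r \<Gamma> =
    (\<Sum>\<^sub>\<infinity>(x, n)\<in>\<Gamma>.
       ennreal (exp (- r * real n + (SUP y\<in>bowen_ball X f n x \<epsilon>. \<Sum>k<n. \<theta> ((f ^^ k) y)))))"

definition bowen_covers ::
    "'a::metric_space set \<Rightarrow> ('a \<Rightarrow> 'a) \<Rightarrow> 'a set \<Rightarrow> real \<Rightarrow> nat \<Rightarrow> ('a \<times> nat) set set" where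
  "bowen_covers X f Z \<epsilon> N =
    {\<Gamma>. countable \<Gamma> \<and> \<Gamma> \<subseteq> X \<times> {N..} \<and> Z \<subseteq> (\<Union>(x, n)\<in>\<Gamma>. bowen_ball X f n x \<epsilon>)}"

definition pressure_premeasure ::
    "'a::metric_space set \<Rightarrow> ('a \<Rightarrow> 'a) \<Rightarrow> ('a \<Rightarrow> real) \<Rightarrow> 'a set \<Rightarrow> real \<Rightarrow> real \<Rightarrow> nat \<Rightarrow> ennreal" where
  "pressure_premeasure X f \<theta> Z r \<epsilon> N =
    (INF \<Gamma>\<in>bowen_covers X f Z \<epsilon> N. pressure_sum X f \<theta> \<epsilon> r \<Gamma>)"

definition pressure_measure ::
    "'a::metric_space set \<Rightarrow> ('a \<Rightarrow> 'a) \<Rightarrow> ('a \<Rightarrow> real) \<Rightarrow> 'a set \<Rightarrow> real \<Rightarrow> real \<Rightarrow> ennreal" where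
  "pressure_measure X f \<theta> Z r \<epsilon> = lim (\<lambda>N. pressure_premeasure X f \<theta> Z r \<epsilon> N)"

definition pressure_at_scale ::
    "'a::metric_space set \<Rightarrow> ('a \<Rightarrow> 'a) \<Rightarrow> ('a \<Rightarrow> real) \<Rightarrow> 'a set \<Rightarrow> real \<Rightarrow> ereal" where
  "pressure_at_scale X f \<theta> Z \<epsilon> = Inf {ereal r | r. pressure_measure X f \<theta> Z r \<epsilon> = 0}"

definition topological_pressure ::
    "'a::metric_space set \<Rightarrow> ('a \<Rightarrow> 'a) \<Rightarrow> 'a set \<Rightarrow> ('a \<Rightarrow> real) \<Rightarrow> ereal" where
  "topological_pressure X f Z \<theta> = Lim (at_right 0) (\<lambda>\<epsilon>. pressure_at_scale X f \<theta> Z \<epsilon>)"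

end

theory Submission
  imports Defs
begin

text \<open>
  Let \<open>Z\<close> be the level set, \<open>S\<^sub>n\<close> the \<open>n\<close>-th Birkhoff sum, and \<open>p s \<epsilon>\<close> the pressure of \<open>-s \<psi>\<close>
  on \<open>Z\<close> at scale \<open>\<epsilon>\<close>. The idea is that of Bowen's equation. Up to a factor \<open>exp (n \<eta>)\<close>, where
  \<open>\<eta>\<close> tends to \<open>0\<close> with \<open>\<epsilon>\<close>, the map \<open>f\<^sup>n\<close> stretches the part of a Bowen ball of length \<open>n\<close>
  with a given itinerary by \<open>exp (S\<^sub>n \<psi>)\<close>; so the \<open>s\<close>-th power of its diameter is
  comparable to its weight \<open>exp (S\<^sub>n (-s \<psi>))\<close> in the pressure sum. Near parabolic points there is no
  bounded distortion, but the factor \<open>exp (n \<eta>)\<close> is absorbed by changing the parameter \<open>r\<close> of the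
  pressure by a multiple of \<open>\<eta>\<close>. Comparing covers by Bowen balls with covers by small sets
  therefore gives, for \<open>s > 0\<close> and in the limit of small \<open>\<epsilon>\<close>:
  if \<open>Z\<close> has nonzero \<open>s\<close>-dimensional Hausdorff measure, then \<open>p s\<close> is asymptotically nonnegative
  (\<open>eventually_pressure_ge\<close>); if the measure vanishes, then \<open>p s\<close> is asymptotically nonpositive
  (\<open>eventually_pressure_le\<close>).

  Since \<open>\<psi> \<ge> 0\<close>, the pressure decreases in \<open>s\<close>. If \<open>d\<close> were smaller than the dimension of \<open>Z\<close>, every
  \<open>s\<close> between them would satisfy \<open>0 \<le> p s \<le> p d\<close> asymptotically and would be a second zero; if \<open>d\<close>
  were larger than the dimension, one finds a second zero below \<open>d\<close> in the same way. Finally \<open>d \<ge> 0\<close>,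
  as otherwise \<open>s = 0\<close> would be a second zero: the pressure of the zero potential on a nonempty set is
  nonnegative.

  Partition points cause the geometric difficulties, because \<open>f\<close> may jump there or
  have a corner, on the two sides of which \<open>\<psi>\<close> has different values. From Bowen balls to small sets,
  the remedy is that two orbits which stay close and end in a common branch have been in common
  branches all the time (\<open>same_branch_backwards\<close>); so a Bowen ball falls into boundedly many pieces,
  each with a single itinerary, and countably many exceptional points. From small sets to
  Bowen balls, an interval is iterated until its image has length at least \<open>\<epsilon>\<close>. It is cut by a partition point
  at most once (\<open>interval_splits_in_two\<close>), since afterwards the images of both halves have a partition
  point as an end. Each half lies in a Bowen ball whose centre is, at the final time, at distance at
  least \<open>\<epsilon>\<close> from the ends of its branch (\<open>central_point_shadows_interval\<close>), so that this ball does not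
  reach across a corner, where \<open>\<psi>\<close> might be much smaller.

  The pressure is a limit over \<open>\<epsilon>\<close>, written with the total operator \<open>Lim\<close>, and corners obstruct the usual
  argument that this limit exists. At \<open>d\<close> it exists by uniqueness of the zero:
  \<open>Lim\<close> takes one and the same value at all parameters without a limit, so if \<open>d\<close> were such a
  parameter, it would be the only one, and the Lipschitz dependence of \<open>p s \<epsilon>\<close> on \<open>s\<close> would carry the
  existence of limits at the other parameters over to \<open>d\<close>
  (\<open>tendsto_at_unique_zero_of_Lim\<close>).
\<close>

section \<open>Unconditional sums of extended nonnegative reals\<close>

lemma infsum_ennreal_leI:
  fixes f :: "'i \<Rightarrow> ennreal"
  assumes "\<And>F. finite F \<Longrightarrow> F \<subseteq> A \<Longrightarrow> sum f F \<le> b"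
  shows "infsum f A \<le> b"
  by (subst nonneg_infsum_complete) (auto intro: SUP_least assms)

lemma sum_le_infsum_ennreal:
  fixes f :: "'i \<Rightarrow> ennreal"
  assumes "finite F" "F \<subseteq> A"
  shows "sum f F \<le> infsum f A"
  by (subst nonneg_infsum_complete) (simp, rule SUP_upper, simp add: assms)

text \<open>Only an inequality, because \<open>h\<close> may identify indices; the sum over the image counts each value of
  \<open>h\<close> once.\<close>

lemma infsum_image_le_ennreal:
  fixes f :: "'j \<Rightarrow> ennreal"
  shows "infsum f (h ` I) \<le> infsum (f \<circ> h) I"
proof (rule infsum_ennreal_leI)
  fix F assume F: "finite F" "F \<subseteq> h ` I"
  obtain G where G: "G \<subseteq> I" "inj_on h G" "F = h ` G"
    using F(2) by (auto simp: subset_image_inj)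
  have "sum f F = sum (f \<circ> h) G" using G by (simp add: sum.reindex)
  also have "\<dots> \<le> infsum (f \<circ> h) I"
    using G F by (intro sum_le_infsum_ennreal) (auto simp: finite_image_iff)
  finally show "sum f F \<le> infsum (f \<circ> h) I" .
qed

lemma infsum_UN_le_ennreal:
  fixes f :: "'i \<Rightarrow> ennreal"
  shows "infsum f (\<Union>i::nat. A i) \<le> (\<Sum>i. infsum f (A i))"
proof (rule infsum_ennreal_leI)
  fix F assume F: "finite F" "F \<subseteq> (\<Union>i. A i)"
  have part: "sum f G \<le> (\<Sum>i<n. infsum f (A i))" if "finite G" "G \<subseteq> (\<Union>i<n. A i)" for G n
    using that
  proof (induction n arbitrary: G)
    case (Suc n)
    have "sum f G = sum f (G - A n) + sum f (G \<inter> A n)"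
      using Suc.prems by (subst sum.union_disjoint[symmetric]) (auto intro!: sum.cong)
    also have "\<dots> \<le> (\<Sum>i<n. infsum f (A i)) + infsum f (A n)"
    proof (intro add_mono)
      show "sum f (G - A n) \<le> (\<Sum>i<n. infsum f (A i))"
        using Suc.prems by (intro Suc.IH) (auto simp: lessThan_Suc)
      show "sum f (G \<inter> A n) \<le> infsum f (A n)"
        using Suc.prems by (intro sum_le_infsum_ennreal) auto
    qed
    finally show ?case by simp
  qed simp
  have "\<exists>n. F \<subseteq> (\<Union>i<n. A i)"
    using F
  proof (induction F)
    case (insert x F)
    then obtain n i where "F \<subseteq> (\<Union>i<n. A i)" "x \<in> A i" by auto
    then have "insert x F \<subseteq> (\<Union>i<max n (Suc i). A i)"
      by (force simp: less_max_iff_disj)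
    then show ?case by blast
  qed auto
  then obtain n where "F \<subseteq> (\<Union>i<n. A i)" by blast
  then have "sum f F \<le> (\<Sum>i<n. infsum f (A i))" using F part by blast
  also have "\<dots> \<le> (\<Sum>i. infsum f (A i))" by (rule sum_le_suminf) (auto intro: summableI)
  finally show "sum f F \<le> (\<Sum>i. infsum f (A i))" .
qed

section \<open>Hausdorff and Pesin--Pitskel pre-measures as outer measures\<close>

text \<open>The covers that define the pre-measure are sequences. Any countable family can be turned into one by
  filling the gaps of an enumeration with empty sets, which have diameter \<open>0\<close>.\<close>

lemma hausdorff_premeasure_le_infsum:
  fixes U :: "'i \<Rightarrow> 'a::metric_space set"
  assumes "countable I" "Z \<subseteq> (\<Union>i\<in>I. U i)" "0 < \<delta>"
    and "\<And>i. i \<in> I \<Longrightarrow> bounded (U i) \<and> diameter (U i) \<le> \<delta>"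
  shows "hausdorff_premeasure s \<delta> Z \<le> (\<Sum>\<^sub>\<infinity>i\<in>I. ennreal (diameter (U i) powr s))"
proof -
  define V where "V k = (if k \<in> to_nat_on I ` I then U (from_nat_into I k) else {})" for k
  have V_of: "V (to_nat_on I i) = U i" if "i \<in> I" for i
    using that assms(1) by (simp add: V_def)
  have "hausdorff_premeasure s \<delta> Z \<le> (\<Sum>k. ennreal (diameter (V k) powr s))"
    unfolding hausdorff_premeasure_def
  proof (rule INF_lower, safe)
    fix x assume "x \<in> Z"
    then obtain i where "i \<in> I" "x \<in> U i" using assms(2) by blast
    then show "x \<in> (\<Union>k. V k)" using V_of by blast
  next
    fix k
    show "bounded (V k)" "diameter (V k) \<le> \<delta>"
      using assms by (auto simp: V_def diameter_empty)
  qed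
  also have "\<dots> \<le> (\<Sum>\<^sub>\<infinity>i\<in>I. ennreal (diameter (U i) powr s))"
  proof (rule suminf_le_const)
    fix n
    define K where "K = {..<n} \<inter> to_nat_on I ` I"
    have K: "from_nat_into I ` K \<subseteq> I" "inj_on (from_nat_into I) K"
      using assms(1) by (auto simp: K_def inj_on_def)
    have "(\<Sum>k<n. ennreal (diameter (V k) powr s)) = (\<Sum>k\<in>K. ennreal (diameter (V k) powr s))"
      by (rule sum.mono_neutral_right) (auto simp: K_def V_def diameter_empty)
    also have "\<dots> = (\<Sum>k\<in>K. ennreal (diameter (U (from_nat_into I k)) powr s))"
      by (rule sum.cong) (auto simp: K_def V_def)
    also have "\<dots> = (\<Sum>i\<in>from_nat_into I ` K. ennreal (diameter (U i) powr s))"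
      using K by (simp add: sum.reindex)
    also have "\<dots> \<le> (\<Sum>\<^sub>\<infinity>i\<in>I. ennreal (diameter (U i) powr s))"
      using K by (intro sum_le_infsum_ennreal) (auto simp: K_def)
    finally show "(\<Sum>k<n. ennreal (diameter (V k) powr s)) \<le> \<dots>" .
  qed (rule summableI)
  finally show ?thesis .
qed

lemma pressure_premeasure_le_sum:
  "\<Gamma> \<in> bowen_covers X f Z \<epsilon> N \<Longrightarrow> pressure_premeasure X f \<theta> Z r \<epsilon> N \<le> pressure_sum X f \<theta> \<epsilon> r \<Gamma>"
  unfolding pressure_premeasure_def by (rule INF_lower)

lemma pressure_premeasure_mono:
  assumes "Z \<subseteq> Z'"
  shows "pressure_premeasure X f \<theta> Z r \<epsilon> N \<le> pressure_premeasure X f \<theta> Z' r \<epsilon> N"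
  unfolding pressure_premeasure_def
  by (rule INF_superset_mono) (use assms in \<open>auto simp: bowen_covers_def\<close>)

text \<open>Raising \<open>N\<close> leaves fewer admissible covers, so the pre-measures increase and their limit exists.\<close>

lemma pressure_measure_eq_SUP:
  "pressure_measure X f \<theta> Z r \<epsilon> = (SUP N. pressure_premeasure X f \<theta> Z r \<epsilon> N)"
proof -
  have "incseq (pressure_premeasure X f \<theta> Z r \<epsilon>)"
    unfolding incseq_def pressure_premeasure_def
    by (intro allI impI INF_superset_mono) (auto simp: bowen_covers_def)
  then show ?thesis
    unfolding pressure_measure_def by (intro limI LIMSEQ_SUP)
qed

text \<open>The usual argument for outer measures: unite covers of the \<open>Z i\<close> that are optimal up to
  \<open>e / 2\<^sup>i\<^sup>+\<^sup>1\<close>.\<close>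

lemma pressure_premeasure_UN_le:
  "pressure_premeasure X f \<theta> (\<Union>i::nat. Z i) r \<epsilon> N \<le> (\<Sum>i. pressure_premeasure X f \<theta> (Z i) r \<epsilon> N)"
proof (rule ennreal_le_epsilon)
  fix e :: real assume fin: "(\<Sum>i. pressure_premeasure X f \<theta> (Z i) r \<epsilon> N) < top" and e: "0 < e"
  let ?p = "\<lambda>i. pressure_premeasure X f \<theta> (Z i) r \<epsilon> N"
  have "\<exists>\<Gamma>\<in>bowen_covers X f (Z i) \<epsilon> N. pressure_sum X f \<theta> \<epsilon> r \<Gamma> \<le> ?p i + ennreal (e * (1/2)^Suc i)" for i
  proof -
    have "?p i \<le> (\<Sum>i. ?p i)"
      using sum_le_suminf[of ?p "{i}"] by (auto intro: summableI)
    with fin have "?p i < ?p i + ennreal (e * (1/2)^Suc i)"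
      using e ennreal_add_left_cancel_less[of "?p i" 0 "ennreal (e * (1/2)^Suc i)"] by auto
    then show ?thesis
      unfolding pressure_premeasure_def INF_less_iff using less_imp_le by blast
  qed
  then obtain \<Gamma> where \<Gamma>: "\<Gamma> i \<in> bowen_covers X f (Z i) \<epsilon> N"
    "pressure_sum X f \<theta> \<epsilon> r (\<Gamma> i) \<le> ?p i + ennreal (e * (1/2)^Suc i)" for i by metis
  have "(\<Union>i. \<Gamma> i) \<in> bowen_covers X f (\<Union>i. Z i) \<epsilon> N"
    using \<Gamma>(1) unfolding bowen_covers_def by (auto; blast)
  then have "pressure_premeasure X f \<theta> (\<Union>i. Z i) r \<epsilon> N \<le> pressure_sum X f \<theta> \<epsilon> r (\<Union>i. \<Gamma> i)"
    by (rule pressure_premeasure_le_sum)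
  also have "\<dots> \<le> (\<Sum>i. pressure_sum X f \<theta> \<epsilon> r (\<Gamma> i))"
    unfolding pressure_sum_def by (rule infsum_UN_le_ennreal)
  also have "\<dots> \<le> (\<Sum>i. ?p i + ennreal (e * (1/2)^Suc i))"
    by (intro suminf_le \<Gamma> summableI)
  also have "\<dots> = (\<Sum>i. ?p i) + (\<Sum>i. ennreal (e * (1/2)^Suc i))"
    by (rule suminf_add[symmetric]) (auto intro: summableI)
  also have "(\<Sum>i. ennreal (e * (1/2)^Suc i)) = ennreal e"
    using e by (intro suminf_ennreal_eq) (auto intro!: sums_mult[OF power_half_series, of e, simplified] simp: algebra_simps)
  finally show "pressure_premeasure X f \<theta> (\<Union>i. Z i) r \<epsilon> N \<le> (\<Sum>i. ?p i) + ennreal e" .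
qed

lemma pressure_premeasure_empty [simp]: "pressure_premeasure X f \<theta> {} r \<epsilon> N = 0"
proof -
  have "{} \<in> bowen_covers X f {} \<epsilon> N" by (auto simp: bowen_covers_def)
  from pressure_premeasure_le_sum[OF this] show ?thesis by (simp add: pressure_sum_def)
qed

lemma pressure_premeasure_Un_le:
  "pressure_premeasure X f \<theta> (Z \<union> Z') r \<epsilon> N
     \<le> pressure_premeasure X f \<theta> Z r \<epsilon> N + pressure_premeasure X f \<theta> Z' r \<epsilon> N"
proof -
  define W where "W i = (if i = 0 then Z else if i = 1 then Z' else {})" for i :: nat
  have "(\<Union>i. W i) = Z \<union> Z'" by (auto simp: W_def split: if_splits)
  then have "pressure_premeasure X f \<theta> (Z \<union> Z') r \<epsilon> N \<le> (\<Sum>i. pressure_premeasure X f \<theta> (W i) r \<epsilon> N)"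
    using pressure_premeasure_UN_le[of X f \<theta> W r \<epsilon> N] by simp
  also have "\<dots> = (\<Sum>i\<in>{0,1}. pressure_premeasure X f \<theta> (W i) r \<epsilon> N)"
    by (rule suminf_finite) (auto simp: W_def)
  finally show ?thesis by (simp add: W_def)
qed

lemma pressure_premeasure_single_ball_le:
  assumes "Z \<subseteq> bowen_ball X f n x \<epsilon>" "x \<in> X" "N \<le> n"
  shows "pressure_premeasure X f \<theta> Z r \<epsilon> N
     \<le> ennreal (exp (- r * real n + (SUP y\<in>bowen_ball X f n x \<epsilon>. \<Sum>k<n. \<theta> ((f ^^ k) y))))"
proof -
  have "{(x, n)} \<in> bowen_covers X f Z \<epsilon> N" using assms by (auto simp: bowen_covers_def)
  from pressure_premeasure_le_sum[OF this] show ?thesis by (simp add: pressure_sum_def)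
qed

lemma centre_in_bowen_ball: "x \<in> X \<Longrightarrow> 0 < \<epsilon> \<Longrightarrow> x \<in> bowen_ball X f n x \<epsilon>"
  by (simp add: bowen_ball_def)

lemma funpow_in: "f \<in> X \<rightarrow> X \<Longrightarrow> x \<in> X \<Longrightarrow> (f ^^ n) x \<in> X"
  by (induction n) auto

text \<open>A single point can be covered by one very long Bowen ball, whose weight is at most \<open>exp (- r n)\<close>.\<close>

lemma pressure_premeasure_countable_eq_0:
  assumes "countable Z" "Z \<subseteq> X" "f \<in> X \<rightarrow> X" "0 < \<epsilon>" "0 < r" and nonpos: "\<And>x. x \<in> X \<Longrightarrow> \<theta> x \<le> 0"
  shows "pressure_premeasure X f \<theta> Z r \<epsilon> N = 0"
proof -
  have single: "pressure_premeasure X f \<theta> {x} r \<epsilon> N = 0" if "x \<in> X" for x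
  proof -
    have "pressure_premeasure X f \<theta> {x} r \<epsilon> N \<le> ennreal (exp (- r) ^ n)" if "N \<le> n" for n
    proof -
      let ?B = "bowen_ball X f n x \<epsilon>"
      have "(SUP y\<in>?B. \<Sum>k<n. \<theta> ((f ^^ k) y)) \<le> 0"
        using centre_in_bowen_ball[OF \<open>x \<in> X\<close> \<open>0 < \<epsilon>\<close>, of f n]
        by (intro cSUP_least sum_nonpos nonpos funpow_in[OF assms(3)]) (blast, simp add: bowen_ball_def)
      then have "exp (- r * real n + (SUP y\<in>?B. \<Sum>k<n. \<theta> ((f ^^ k) y))) \<le> exp (- r) ^ n"
        by (simp add: exp_of_nat_mult[symmetric] mult.commute)
      moreover have "{x} \<subseteq> ?B" using \<open>x \<in> X\<close> \<open>0 < \<epsilon>\<close> by (simp add: centre_in_bowen_ball)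
      ultimately show ?thesis
        using pressure_premeasure_single_ball_le[of "{x}" X f n x \<epsilon> N \<theta> r] \<open>x \<in> X\<close> that
        by (meson ennreal_leI order_trans)
    qed
    moreover have "(\<lambda>n. ennreal (exp (- r) ^ n)) \<longlonglongrightarrow> ennreal 0"
      using \<open>0 < r\<close> by (intro tendsto_ennrealI LIMSEQ_realpow_zero) auto
    ultimately have "pressure_premeasure X f \<theta> {x} r \<epsilon> N \<le> ennreal 0"
      by (intro LIMSEQ_le_const[of _ "ennreal 0"]) auto
    then show ?thesis by simp
  qed
  show ?thesis
  proof (cases "Z = {}")
    case False
    have "Z = (\<Union>i. {from_nat_into Z i})"
      using range_from_nat_into[OF False assms(1)] by auto
    then have "pressure_premeasure X f \<theta> Z r \<epsilon> N \<le> (\<Sum>i. pressure_premeasure X f \<theta> {from_nat_into Z i} r \<epsilon> N)"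
      by (metis pressure_premeasure_UN_le)
    also have "\<dots> = 0"
      using single from_nat_into[OF False] assms(2) by (simp add: subset_iff)
    finally show ?thesis by simp
  qed simp
qed

text \<open>Potentials and the parameter \<open>r\<close> enter a pressure sum only through Birkhoff sums of \<open>\<theta> - r\<close>. This one
  comparison covers monotonicity in \<open>r\<close>, monotonicity in the potential and the Lipschitz dependence
  on it.\<close>

lemma pressure_measure_mono_potential:
  assumes f: "f \<in> X \<rightarrow> X" and "0 < \<epsilon>" and bdd: "\<And>x. x \<in> X \<Longrightarrow> \<theta>' x \<le> M"
    and le: "\<And>x. x \<in> X \<Longrightarrow> \<theta> x - r \<le> \<theta>' x - r'"
  shows "pressure_measure X f \<theta> Z r \<epsilon> \<le> pressure_measure X f \<theta>' Z r' \<epsilon>"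
proof -
  have exponent_le: "- r * real n + (SUP y\<in>bowen_ball X f n x \<epsilon>. \<Sum>k<n. \<theta> ((f ^^ k) y))
      \<le> - r' * real n + (SUP y\<in>bowen_ball X f n x \<epsilon>. \<Sum>k<n. \<theta>' ((f ^^ k) y))" if "x \<in> X" for x n
  proof -
    let ?B = "bowen_ball X f n x \<epsilon>"
    have orbit: "(f ^^ k) y \<in> X" if "y \<in> ?B" for y k
      using that f by (intro funpow_in) (auto simp: bowen_ball_def)
    have "(\<Sum>k<n. \<theta>' ((f ^^ k) y)) \<le> real n * M" if "y \<in> ?B" for y
      using sum_bounded_above[of "{..<n}" "\<lambda>k. \<theta>' ((f ^^ k) y)" M] bdd orbit[OF that] by simp
    then have bdd_B: "bdd_above ((\<lambda>y. \<Sum>k<n. \<theta>' ((f ^^ k) y)) ` ?B)" by (rule bdd_aboveI2)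
    have "(SUP y\<in>?B. \<Sum>k<n. \<theta> ((f ^^ k) y)) \<le> (r - r') * n + (SUP y\<in>?B. \<Sum>k<n. \<theta>' ((f ^^ k) y))"
    proof (rule cSUP_least)
      show "?B \<noteq> {}" using centre_in_bowen_ball[OF \<open>x \<in> X\<close> \<open>0 < \<epsilon>\<close>] by blast
      fix y assume y: "y \<in> ?B"
      have "(\<Sum>k<n. \<theta> ((f ^^ k) y)) \<le> (\<Sum>k<n. \<theta>' ((f ^^ k) y) + (r - r'))"
        by (intro sum_mono) (use le[OF orbit[OF y]] in \<open>simp add: algebra_simps\<close>)
      also have "\<dots> = (r - r') * n + (\<Sum>k<n. \<theta>' ((f ^^ k) y))"
        by (simp add: sum.distrib)
      also have "\<dots> \<le> (r - r') * n + (SUP y\<in>?B. \<Sum>k<n. \<theta>' ((f ^^ k) y))"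
        using cSUP_upper[OF y bdd_B] by simp
      finally show "(\<Sum>k<n. \<theta> ((f ^^ k) y)) \<le> \<dots>" .
    qed
    then show ?thesis by (simp add: algebra_simps)
  qed
  have "pressure_sum X f \<theta> \<epsilon> r \<Gamma> \<le> pressure_sum X f \<theta>' \<epsilon> r' \<Gamma>" if \<Gamma>: "\<Gamma> \<in> bowen_covers X f Z \<epsilon> N" for \<Gamma> N
    unfolding pressure_sum_def
  proof (rule infsum_mono)
    fix p assume "p \<in> \<Gamma>"
    then obtain x n where "p = (x, n)" "x \<in> X" using \<Gamma> by (auto simp: bowen_covers_def)
    then show "(case p of (x, n) \<Rightarrow> ennreal (exp (- r * real n + (SUP y\<in>bowen_ball X f n x \<epsilon>. \<Sum>k<n. \<theta> ((f ^^ k) y)))))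
      \<le> (case p of (x, n) \<Rightarrow> ennreal (exp (- r' * real n + (SUP y\<in>bowen_ball X f n x \<epsilon>. \<Sum>k<n. \<theta>' ((f ^^ k) y)))))"
      using exponent_le[of x n] by (auto intro!: ennreal_leI)
  qed (rule nonneg_summable_on_complete, simp)+
  then show ?thesis
    unfolding pressure_measure_eq_SUP pressure_premeasure_def
    by (intro SUP_mono' INF_mono) blast
qed

lemma pressure_at_scale_le:
  "pressure_measure X f \<theta> Z r \<epsilon> = 0 \<Longrightarrow> pressure_at_scale X f \<theta> Z \<epsilon> \<le> ereal r"
  unfolding pressure_at_scale_def by (intro Inf_lower) auto

lemma pressure_at_scale_ge:
  assumes f: "f \<in> X \<rightarrow> X" and "0 < \<epsilon>" and bdd: "\<And>x. x \<in> X \<Longrightarrow> \<theta> x \<le> M"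
    and pos: "pressure_measure X f \<theta> Z r \<epsilon> \<noteq> 0"
  shows "ereal r \<le> pressure_at_scale X f \<theta> Z \<epsilon>"
  unfolding pressure_at_scale_def
proof (rule Inf_greatest, safe)
  fix r' assume 0: "pressure_measure X f \<theta> Z r' \<epsilon> = 0"
  have "r \<le> r'"
  proof (rule ccontr)
    assume "\<not> r \<le> r'"
    then have "pressure_measure X f \<theta> Z r \<epsilon> \<le> pressure_measure X f \<theta> Z r' \<epsilon>"
      using f \<open>0 < \<epsilon>\<close> bdd by (intro pressure_measure_mono_potential) auto
    with 0 pos show False by simp
  qed
  then show "ereal r \<le> ereal r'" by simp
qed

lemma pressure_at_scale_mono_add:
  assumes f: "f \<in> X \<rightarrow> X" and "0 < \<epsilon>" and bdd: "\<And>x. x \<in> X \<Longrightarrow> \<theta>' x \<le> M"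
    and le: "\<And>x. x \<in> X \<Longrightarrow> \<theta> x \<le> \<theta>' x + c"
  shows "pressure_at_scale X f \<theta> Z \<epsilon> \<le> pressure_at_scale X f \<theta>' Z \<epsilon> + ereal c"
proof -
  have "pressure_at_scale X f \<theta> Z \<epsilon> - ereal c \<le> pressure_at_scale X f \<theta>' Z \<epsilon>"
    unfolding pressure_at_scale_def[of X f \<theta>']
  proof (rule Inf_greatest, safe)
    fix r assume 0: "pressure_measure X f \<theta>' Z r \<epsilon> = 0"
    have "pressure_measure X f \<theta> Z (r + c) \<epsilon> \<le> pressure_measure X f \<theta>' Z r \<epsilon>"
    proof (rule pressure_measure_mono_potential[OF f \<open>0 < \<epsilon>\<close> bdd])
      show "\<theta> x - (r + c) \<le> \<theta>' x - r" if "x \<in> X" for x using le[OF that] by simp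
    qed
    with 0 have "pressure_at_scale X f \<theta> Z \<epsilon> \<le> ereal (r + c)"
      by (intro pressure_at_scale_le) simp
    then show "pressure_at_scale X f \<theta> Z \<epsilon> - ereal c \<le> ereal r"
      by (simp add: ereal_minus_le)
  qed
  then show ?thesis by (simp add: ereal_minus_le)
qed

section \<open>Partitions of the unit interval\<close>

locale unit_partition =
  fixes m :: nat and a :: "nat \<Rightarrow> real"
  assumes m_pos: "0 < m" and a_0: "a 0 = 0" and a_m: "a m = 1" and a_less: "i < m \<Longrightarrow> a i < a (Suc i)"
begin

definition mesh :: real where
  "mesh = Min ((\<lambda>i. a (Suc i) - a i) ` {..<m})"

lemma mesh_pos: "0 < mesh"
  unfolding mesh_def using m_pos a_less by (subst Min_gr_iff) auto

lemma mesh_le: "i < m \<Longrightarrow> mesh \<le> a (Suc i) - a i"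
  unfolding mesh_def by (intro Min_le) auto

lemma a_mono: "i \<le> j \<Longrightarrow> j \<le> m \<Longrightarrow> a i \<le> a j"
proof (induction j rule: dec_induct)
  case (step j)
  then show ?case using a_less[of j] by simp
qed simp

lemma a_less_iff: "i \<le> m \<Longrightarrow> j \<le> m \<Longrightarrow> a i < a j \<longleftrightarrow> i < j"
proof -
  have "a i < a j" if "i < j" "j \<le> m" for i j
    using that a_less[of i] a_mono[of "Suc i" j] by simp
  then show "i \<le> m \<Longrightarrow> j \<le> m \<Longrightarrow> a i < a j \<longleftrightarrow> i < j"
    by (metis less_irrefl linorder_neqE_nat order_less_asym)
qed

lemma a_in: "i \<le> m \<Longrightarrow> a i \<in> {0..1}"
  using a_mono[of 0 i] a_mono[of i m] a_0 a_m by simp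

lemma branch_subset: "i < m \<Longrightarrow> {a i..a (Suc i)} \<subseteq> {0..1}"
  using a_in[of i] a_in[of "Suc i"] by auto

lemma partition_point_outside_branch:
  assumes "p \<in> a ` {..m}" "j < m" shows "p \<le> a j \<or> a (Suc j) \<le> p"
proof -
  obtain k where "k \<le> m" "p = a k" using assms(1) by auto
  then show ?thesis
    using assms(2) a_mono[of k j] a_mono[of "Suc j" k] by (cases "k \<le> j") auto
qed

lemma left_end_exists:
  assumes "0 \<le> x" "x < 1" obtains i where "i < m" "a i \<le> x" "x < a (Suc i)"
proof -
  define i where "i = Max {k. k \<le> m \<and> a k \<le> x}"
  have fin: "finite {k. k \<le> m \<and> a k \<le> x}" by simp
  have "0 \<in> {k. k \<le> m \<and> a k \<le> x}" using assms(1) a_0 by simp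
  then have "i \<in> {k. k \<le> m \<and> a k \<le> x}" unfolding i_def by (intro Max_in[OF fin]) blast
  then have i: "i \<le> m" "a i \<le> x" by auto
  have "i \<noteq> m" using i assms a_m by auto
  moreover have "x < a (Suc i)"
  proof (rule ccontr)
    assume "\<not> x < a (Suc i)"
    with i \<open>i \<noteq> m\<close> have "Suc i \<le> i" using Max_ge[OF fin, of "Suc i"] by (simp add: i_def[symmetric])
    then show False by simp
  qed
  ultimately show ?thesis using i that[of i] by simp
qed

lemma branch_exists:
  assumes "x \<in> {0..1}" "x \<notin> a ` {..m}" obtains i where "i < m" "x \<in> {a i<..<a (Suc i)}"
proof -
  have "x \<noteq> 1" using assms(2) a_m by force
  then obtain i where i: "i < m" "a i \<le> x" "x < a (Suc i)"
    using left_end_exists[of x] assms(1) by auto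
  then show ?thesis using assms(2) that[of i] by (force simp: image_iff)
qed

definition same_branch :: "real \<Rightarrow> real \<Rightarrow> bool" where
  "same_branch x y \<longleftrightarrow> (\<exists>i<m. x \<in> {a i<..<a (Suc i)} \<and> y \<in> {a i<..<a (Suc i)})"

lemma same_branch_sym: "same_branch x y \<Longrightarrow> same_branch y x"
  by (auto simp: same_branch_def)

lemma same_branch_trans:
  assumes "same_branch x y" "same_branch y z" shows "same_branch x z"
proof -
  obtain i i' where *: "i < m" "x \<in> {a i<..<a (Suc i)}" "y \<in> {a i<..<a (Suc i)}"
    "i' < m" "y \<in> {a i'<..<a (Suc i')}" "z \<in> {a i'<..<a (Suc i')}"
    using assms unfolding same_branch_def by blast
  then have "a i < a (Suc i')" "a i' < a (Suc i)" by auto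
  then have "i = i'" using a_less_iff[of i "Suc i'"] a_less_iff[of i' "Suc i"] * by simp
  then show ?thesis using * unfolding same_branch_def by blast
qed

end

section \<open>Expanding maps with monotone branches\<close>

text \<open>What is used of a piecewise smooth expanding map. The functions \<open>g i\<close> extend the branches to the
  closed intervals, and \<open>\<psi>\<close> plays the role of the logarithm of the derivative: apart from
  its bounds, it enters only through the mean value property \<open>g_mvt\<close> and its modulus of continuity
  inside the branches. In \<open>growth\<close>, the constant \<open>c\<close> depends on \<open>\<delta>\<close> only; this is a form of expansion that survives in the
  presence of parabolic points.\<close>

locale expanding_branches = unit_partition m a
  for m :: nat and a :: "nat \<Rightarrow> real" +
  fixes f \<psi> :: "real \<Rightarrow> real" and g :: "nat \<Rightarrow> real \<Rightarrow> real" and \<Lambda> :: real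
  assumes f_maps: "f \<in> {0..1} \<rightarrow> {0..1}"
    and psi_nonneg: "x \<in> {0..1} \<Longrightarrow> 0 \<le> \<psi> x" and psi_le: "x \<in> {0..1} \<Longrightarrow> \<psi> x \<le> \<Lambda>"
    and f_eq_g: "i < m \<Longrightarrow> x \<in> {a i<..<a (Suc i)} \<Longrightarrow> f x = g i x"
    and f_partition: "k \<le> m \<Longrightarrow> f (a k) \<in> a ` {..m}"
    and g_left: "i < m \<Longrightarrow> g i (a i) \<in> a ` {..m}"
    and g_right: "i < m \<Longrightarrow> g i (a (Suc i)) \<in> a ` {..m}"
    and g_cont: "i < m \<Longrightarrow> continuous_on {a i..a (Suc i)} (g i)"
    and g_mvt: "i < m \<Longrightarrow> a i \<le> u \<Longrightarrow> u < v \<Longrightarrow> v \<le> a (Suc i)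
      \<Longrightarrow> \<exists>\<xi>\<in>{u<..<v}. g i v - g i u = exp (\<psi> \<xi>) * (v - u)"
    and psi_ucont: "0 < \<eta> \<Longrightarrow> \<exists>\<rho>>0. \<forall>i<m. \<forall>x\<in>{a i<..<a (Suc i)}. \<forall>y\<in>{a i<..<a (Suc i)}.
      \<bar>x - y\<bar> < \<rho> \<longrightarrow> \<bar>\<psi> x - \<psi> y\<bar> \<le> \<eta>"
    and growth: "0 < \<delta> \<Longrightarrow> \<exists>c>0. \<forall>i<m. \<forall>u v. a i \<le> u \<longrightarrow> u + \<delta> \<le> v \<longrightarrow> v \<le> a (Suc i)
      \<longrightarrow> v - u + c \<le> g i v - g i u"
begin

lemma g_expands:
  assumes "i < m" "a i \<le> u" "u \<le> v" "v \<le> a (Suc i)"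
  shows "v - u \<le> g i v - g i u"
proof (cases "u = v")
  case False
  then obtain \<xi> where \<xi>: "\<xi> \<in> {u<..<v}" "g i v - g i u = exp (\<psi> \<xi>) * (v - u)"
    using g_mvt[of i u v] assms by auto
  have "1 \<le> exp (\<psi> \<xi>)" using \<xi>(1) assms branch_subset[of i] psi_nonneg[of \<xi>] by auto
  then show ?thesis using \<xi>(2) assms mult_right_mono[of 1 "exp (\<psi> \<xi>)" "v - u"] by simp
qed simp

lemma g_strict: "i < m \<Longrightarrow> a i \<le> u \<Longrightarrow> u < v \<Longrightarrow> v \<le> a (Suc i) \<Longrightarrow> g i u < g i v"
  using g_expands[of i u v] by simp

lemma g_lipschitz:
  assumes "i < m" "a i \<le> u" "u \<le> v" "v \<le> a (Suc i)"
  shows "g i v - g i u \<le> exp \<Lambda> * (v - u)"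
proof (cases "u = v")
  case False
  then obtain \<xi> where \<xi>: "\<xi> \<in> {u<..<v}" "g i v - g i u = exp (\<psi> \<xi>) * (v - u)"
    using g_mvt[of i u v] assms by auto
  have "exp (\<psi> \<xi>) \<le> exp \<Lambda>" using \<xi>(1) assms branch_subset[of i] psi_le[of \<xi>] by auto
  then show ?thesis using \<xi>(2) assms by (simp add: mult_right_mono)
qed simp

lemma g_in:
  assumes "i < m" "a i \<le> u" "u \<le> a (Suc i)"
  shows "g i u \<in> {0..1}"
proof -
  have "g i (a i) \<in> {0..1}" "g i (a (Suc i)) \<in> {0..1}"
    using g_left[OF assms(1)] g_right[OF assms(1)] a_in by auto
  then show ?thesis using g_expands[of i "a i" u] g_expands[of i u "a (Suc i)"] assms by auto
qed

lemma g_ivt: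
  assumes "i < m" "a i \<le> u" "u \<le> v" "v \<le> a (Suc i)" "g i u \<le> y" "y \<le> g i v"
  obtains x where "u \<le> x" "x \<le> v" "g i x = y"
proof -
  have "continuous_on {u..v} (g i)" using assms by (auto intro: continuous_on_subset[OF g_cont])
  then show ?thesis using IVT'[of "g i" u y v] assms that by auto
qed

lemma g_less_iff:
  assumes "i < m" "u \<in> {a i..a (Suc i)}" "v \<in> {a i..a (Suc i)}"
  shows "g i u < g i v \<longleftrightarrow> u < v"
  using g_strict[of i u v] g_strict[of i v u] assms by (cases u v rule: linorder_cases) auto

lemma f_expands:
  assumes "same_branch x y" shows "\<bar>x - y\<bar> \<le> \<bar>f x - f y\<bar>"
proof -
  obtain i where i: "i < m" "x \<in> {a i<..<a (Suc i)}" "y \<in> {a i<..<a (Suc i)}"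
    using assms by (auto simp: same_branch_def)
  then show ?thesis
    using g_expands[of i x y] g_expands[of i y x] f_eq_g[OF i(1)] by (cases "x \<le> y") auto
qed

text \<open>The Markov property in the form in which it is used: the image of a branch is an interval
  between two partition points, so it contains every branch that it meets.\<close>

lemma branch_image_covers:
  assumes "i < m" "x \<in> {a i<..<a (Suc i)}" "same_branch (f x) y"
  obtains z where "z \<in> {a i<..<a (Suc i)}" "f z = y"
proof -
  obtain j where j: "j < m" "f x \<in> {a j<..<a (Suc j)}" "y \<in> {a j<..<a (Suc j)}"
    using assms(3) by (auto simp: same_branch_def)
  have fx: "g i (a i) < f x" "f x < g i (a (Suc i))"
    using assms g_strict[of i "a i" x] g_strict[of i x "a (Suc i)"] f_eq_g by auto
  have y: "g i (a i) < y" "y < g i (a (Suc i))"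
    using partition_point_outside_branch[OF g_left[OF assms(1)] j(1)]
      partition_point_outside_branch[OF g_right[OF assms(1)] j(1)] fx j by auto
  obtain z where z: "a i \<le> z" "z \<le> a (Suc i)" "g i z = y"
    using g_ivt[of i "a i" "a (Suc i)" y] assms(1) a_less[of i] y by auto
  then have "z \<in> {a i<..<a (Suc i)}" using y by (auto simp: less_le)
  then show ?thesis using that z f_eq_g[OF assms(1)] by auto
qed

text \<open>If \<open>x < y\<close> were in different branches, both would be within \<open>2 \<epsilon>\<close> of partition points between them. The image
  of \<open>x\<close> would then be near the right end of the image of its branch, and the image of \<open>y\<close> near
  the left end of the image of its branch. As these ends are partition points and both images lie in one branch, \<open>f x\<close> is near the
  right end of that branch and \<open>f y\<close> near its left end, which is too far apart. Here near means within
  \<open>2 \<epsilon> exp \<Lambda>\<close>, so together with the distance \<open>2 \<epsilon>\<close> of the images this contradicts the lower bound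
  \<open>(4 exp \<Lambda> + 2) \<epsilon>\<close> for the length of a branch.\<close>

lemma same_branch_pullback:
  assumes x: "x \<in> {0..1}" and y: "y \<in> {0..1}" and \<epsilon>: "(4 * exp \<Lambda> + 2) * \<epsilon> \<le> mesh"
    and close: "\<bar>x - y\<bar> < 2 * \<epsilon>" "\<bar>f x - f y\<bar> < 2 * \<epsilon>" and same: "same_branch (f x) (f y)"
  shows "same_branch x y"
proof -
  have notin: "z \<notin> a ` {..m}" if "same_branch (f z) w" for z w
  proof
    assume "z \<in> a ` {..m}"
    then have "f z \<in> a ` {..m}" using f_partition by auto
    with that partition_point_outside_branch show False by (force simp: same_branch_def)
  qed
  have main: "i = i'" if ii: "i < m" "x \<in> {a i<..<a (Suc i)}" "i' < m" "y \<in> {a i'<..<a (Suc i')}"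
    and "x < y" and close: "\<bar>x - y\<bar> < 2 * \<epsilon>" "\<bar>f x - f y\<bar> < 2 * \<epsilon>" and same: "same_branch (f x) (f y)"
    for x y i i'
  proof (rule ccontr)
    assume "i \<noteq> i'"
    have "a i < a (Suc i')" using ii \<open>x < y\<close> by simp
    then have "i < i'" using a_less_iff[of i "Suc i'"] ii \<open>i \<noteq> i'\<close> by simp
    then have ee: "a (Suc i) \<le> a i'" using ii by (intro a_mono) auto
    obtain j where j: "j < m" "f x \<in> {a j<..<a (Suc j)}" "f y \<in> {a j<..<a (Suc j)}"
      using same by (auto simp: same_branch_def)
    have "f x < g i (a (Suc i))" "g i' (a i') < f y"
      using ii g_strict[of i x "a (Suc i)"] g_strict[of i' "a i'" y] f_eq_g by auto
    then have ends: "a (Suc j) \<le> g i (a (Suc i))" "g i' (a i') \<le> a j"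
      using partition_point_outside_branch[OF g_right[OF ii(1)] j(1)]
        partition_point_outside_branch[OF g_left[OF ii(3)] j(1)] j by auto
    have "g i (a (Suc i)) - f x \<le> exp \<Lambda> * (a (Suc i) - x)" "f y - g i' (a i') \<le> exp \<Lambda> * (y - a i')"
      using ii g_lipschitz[of i x "a (Suc i)"] g_lipschitz[of i' "a i'" y] f_eq_g by auto
    moreover have "exp \<Lambda> * (a (Suc i) - x) \<le> exp \<Lambda> * (2 * \<epsilon>)" "exp \<Lambda> * (y - a i') \<le> exp \<Lambda> * (2 * \<epsilon>)"
      using ii ee close by (auto intro!: mult_left_mono)
    ultimately have "a (Suc j) - a j - exp \<Lambda> * (4 * \<epsilon>) \<le> f x - f y" using ends by (simp add: algebra_simps)
    then show False using mesh_le[OF j(1)] close \<epsilon> by (simp add: algebra_simps)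
  qed
  obtain i where i: "i < m" "x \<in> {a i<..<a (Suc i)}" using branch_exists[OF x notin[OF same]] .
  obtain i' where i': "i' < m" "y \<in> {a i'<..<a (Suc i')}"
    using branch_exists[OF y notin[OF same_branch_sym[OF same]]] .
  show ?thesis
  proof (cases x y rule: linorder_cases)
    case less
    then show ?thesis using main[OF i i' less close same] i i' by (auto simp: same_branch_def)
  next
    case equal
    then show ?thesis using i by (auto simp: same_branch_def)
  next
    case greater
    then have "i' = i"
      using main[OF i' i] close same_branch_sym[OF same] by (simp add: abs_minus_commute)
    then show ?thesis using i i' by (auto simp: same_branch_def)
  qed
qed

lemma same_branch_backwards:
  assumes \<epsilon>: "(4 * exp \<Lambda> + 2) * \<epsilon> \<le> mesh" and "x \<in> {0..1}" "y \<in> {0..1}"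
    and "\<And>i. i \<le> n \<Longrightarrow> \<bar>(f ^^ i) x - (f ^^ i) y\<bar> < 2 * \<epsilon>" and "same_branch ((f ^^ n) x) ((f ^^ n) y)"
    and "i \<le> n"
  shows "same_branch ((f ^^ i) x) ((f ^^ i) y)"
  using assms(2-)
proof (induction n arbitrary: x y i)
  case (Suc n)
  have fx: "f x \<in> {0..1}" "f y \<in> {0..1}" using Suc.prems f_maps by auto
  have close: "\<bar>(f ^^ k) (f x) - (f ^^ k) (f y)\<bar> < 2 * \<epsilon>" if "k \<le> n" for k
    using Suc.prems(3)[of "Suc k"] that by (simp add: funpow_swap1)
  have IH: "same_branch ((f ^^ k) (f x)) ((f ^^ k) (f y))" if "k \<le> n" for k
    using Suc.IH[OF fx close _ that] Suc.prems(4) by (simp add: funpow_swap1)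
  show ?case
  proof (cases i)
    case 0
    then show ?thesis
      using same_branch_pullback[OF Suc.prems(1,2) \<epsilon>] Suc.prems(3)[of 0] close[of 0] IH[of 0] by simp
  next
    case (Suc k)
    then show ?thesis using IH[of k] \<open>i \<le> Suc n\<close> by (simp add: funpow_swap1)
  qed
qed simp

section \<open>Distortion and expansivity along a common itinerary\<close>

abbreviation birkhoff_sum :: "nat \<Rightarrow> real \<Rightarrow> real" where
  "birkhoff_sum n x \<equiv> \<Sum>k<n. \<psi> ((f ^^ k) x)"

lemma birkhoff_sum_Suc: "birkhoff_sum (Suc n) x = \<psi> x + birkhoff_sum n (f x)"
  by (subst sum.lessThan_Suc_shift) (simp add: funpow_swap1)

text \<open>A modulus of continuity for \<open>\<psi>\<close> inside the branches; across a partition point \<open>\<psi>\<close> may jump.\<close>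

definition distortion_radius :: "real \<Rightarrow> real \<Rightarrow> bool" where
  "distortion_radius \<eta> \<rho> \<longleftrightarrow> (\<forall>x y. same_branch x y \<longrightarrow> \<bar>x - y\<bar> < \<rho> \<longrightarrow> \<bar>\<psi> x - \<psi> y\<bar> \<le> \<eta>)"

lemma distortion_radius_exists:
  assumes "0 < \<eta>" obtains \<rho> where "0 < \<rho>" "distortion_radius \<eta> \<rho>"
  using psi_ucont[OF assms] unfolding distortion_radius_def same_branch_def by blast

lemma f_expands_by_psi:
  assumes "distortion_radius \<eta> \<rho>" "same_branch x y" "\<bar>x - y\<bar> < \<rho>"
  shows "exp (\<psi> x - \<eta>) * \<bar>x - y\<bar> \<le> \<bar>f x - f y\<bar>"
proof -
  obtain i where i: "i < m" "x \<in> {a i<..<a (Suc i)}" "y \<in> {a i<..<a (Suc i)}"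
    using assms(2) by (auto simp: same_branch_def)
  have main: "exp (\<psi> x - \<eta>) * (v - u) \<le> f v - f u"
    if "u < v" "{u, v} = {x, y}" for u v
  proof -
    have uv: "u \<in> {a i<..<a (Suc i)}" "v \<in> {a i<..<a (Suc i)}" using that i by (auto simp: doubleton_eq_iff)
    obtain \<xi> where \<xi>: "\<xi> \<in> {u<..<v}" "g i v - g i u = exp (\<psi> \<xi>) * (v - u)"
      using g_mvt[of i u v] i(1) uv \<open>u < v\<close> by auto
    have "same_branch x \<xi>" "\<bar>x - \<xi>\<bar> < \<rho>"
      using \<xi>(1) uv i assms(3) that by (auto simp: same_branch_def doubleton_eq_iff)
    then have "\<psi> x - \<eta> \<le> \<psi> \<xi>" using assms(1) by (force simp: distortion_radius_def)
    then show ?thesis using \<xi>(2) \<open>u < v\<close> f_eq_g[OF i(1)] uv by simp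
  qed
  show ?thesis
    using main[of x y] main[of y x] by (cases x y rule: linorder_cases) (auto simp: insert_commute)
qed

text \<open>Pulling back by \<open>f\<close> from the final time, each step contracts by \<open>exp (\<psi> - \<eta>)\<close>; at the final
  time the distance is at most \<open>1\<close>.\<close>

lemma contraction_along_common_itinerary:
  assumes "distortion_radius \<eta> \<rho>" "x \<in> {0..1}" "y \<in> {0..1}"
    and "\<And>i. i < n \<Longrightarrow> same_branch ((f ^^ i) x) ((f ^^ i) y)"
    and "\<And>i. i < n \<Longrightarrow> \<bar>(f ^^ i) x - (f ^^ i) y\<bar> < \<rho>"
  shows "\<bar>x - y\<bar> \<le> exp (n * \<eta> - birkhoff_sum n x)"
  using assms(2-)
proof (induction n arbitrary: x y)
  case (Suc n)
  have fx: "f x \<in> {0..1}" "f y \<in> {0..1}" using Suc.prems f_maps by auto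
  have "\<bar>f x - f y\<bar> \<le> exp (n * \<eta> - birkhoff_sum n (f x))"
    using Suc.IH[OF fx] Suc.prems(3)[of "Suc _"] Suc.prems(4)[of "Suc _"] by (simp add: funpow_swap1)
  moreover have "exp (\<psi> x - \<eta>) * \<bar>x - y\<bar> \<le> \<bar>f x - f y\<bar>"
    using f_expands_by_psi[OF assms(1)] Suc.prems(3)[of 0] Suc.prems(4)[of 0] by simp
  ultimately have "exp (\<psi> x - \<eta>) * \<bar>x - y\<bar> \<le> exp (n * \<eta> - birkhoff_sum n (f x))" by simp
  then have "\<bar>x - y\<bar> \<le> exp (n * \<eta> - birkhoff_sum n (f x)) / exp (\<psi> x - \<eta>)"
    by (simp add: field_simps)
  also have "\<dots> = exp (Suc n * \<eta> - birkhoff_sum (Suc n) x)"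
    by (simp add: birkhoff_sum_Suc algebra_simps flip: exp_diff del: sum.lessThan_Suc)
  finally show ?case .
qed auto

text \<open>A distance of at least \<open>\<delta>\<close> within a branch grows by a fixed amount at every step, which can happen
  only finitely often in the unit interval. Thus the pieces of long Bowen balls are
  uniformly small even though parabolic points prevent exponential contraction.\<close>

lemma expansive:
  assumes "0 < \<delta>"
  obtains N where "\<And>n x y. N \<le> n \<Longrightarrow> x \<in> {0..1} \<Longrightarrow> y \<in> {0..1}
      \<Longrightarrow> (\<And>i. i < n \<Longrightarrow> same_branch ((f ^^ i) x) ((f ^^ i) y)) \<Longrightarrow> \<bar>x - y\<bar> < \<delta>"
proof -
  obtain c where c: "0 < c" and grow: "\<And>i u v. i < m \<Longrightarrow> a i \<le> u \<Longrightarrow> u + \<delta> \<le> v \<Longrightarrow> v \<le> a (Suc i)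
      \<Longrightarrow> v - u + c \<le> g i v - g i u"
    using growth[OF assms] by blast
  have step: "\<bar>x - y\<bar> + c \<le> \<bar>f x - f y\<bar>" if "same_branch x y" "\<delta> \<le> \<bar>x - y\<bar>" for x y
  proof -
    obtain i where i: "i < m" "x \<in> {a i<..<a (Suc i)}" "y \<in> {a i<..<a (Suc i)}"
      using \<open>same_branch x y\<close> by (auto simp: same_branch_def)
    then show ?thesis
      using grow[of i x y] grow[of i y x] f_eq_g[OF i(1)] that(2) by (cases "x \<le> y") auto
  qed
  have far: "\<delta> + n * c \<le> 1"
    if "x \<in> {0..1}" "y \<in> {0..1}" "\<delta> \<le> \<bar>x - y\<bar>" and same: "\<And>i. i < n \<Longrightarrow> same_branch ((f ^^ i) x) ((f ^^ i) y)"
    for n :: nat and x y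
  proof -
    have "\<delta> + i * c \<le> \<bar>(f ^^ i) x - (f ^^ i) y\<bar>" if "i \<le> n" for i
      using that
    proof (induction i)
      case (Suc i)
      then have IH: "\<delta> + i * c \<le> \<bar>(f ^^ i) x - (f ^^ i) y\<bar>" by simp
      moreover have "0 \<le> i * c" using c by simp
      ultimately have "\<bar>(f ^^ i) x - (f ^^ i) y\<bar> + c \<le> \<bar>f ((f ^^ i) x) - f ((f ^^ i) y)\<bar>"
        using \<open>Suc i \<le> n\<close> by (intro step same) auto
      then show ?case using IH by (simp add: algebra_simps)
    qed (use \<open>\<delta> \<le> \<bar>x - y\<bar>\<close> in simp)
    from this[of n] have "\<delta> + n * c \<le> \<bar>(f ^^ n) x - (f ^^ n) y\<bar>" by simp
    moreover have "(f ^^ n) x \<in> {0..1}" "(f ^^ n) y \<in> {0..1}"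
      using that by (intro funpow_in[OF f_maps]; simp)+
    ultimately show ?thesis by auto
  qed
  obtain N :: nat where N: "1 < N * c" using ex_less_of_nat_mult[OF c] by blast
  show ?thesis
  proof (rule that[of N], rule ccontr)
    fix n x y
    assume n: "N \<le> n" and *: "x \<in> {0..1}" "y \<in> {0..1}" "\<And>i. i < n \<Longrightarrow> same_branch ((f ^^ i) x) ((f ^^ i) y)"
      and "\<not> \<bar>x - y\<bar> < \<delta>"
    then have "\<delta> + n * c \<le> 1" using far[of x y n] by auto
    moreover have "real N * c \<le> n * c" using n c by simp
    ultimately show False using N assms by simp
  qed
qed

section \<open>Bowen covers yield Hausdorff covers\<close>

text \<open>Points whose orbit meets the partition have no itinerary. There are countably many of them, hence they are
  negligible for Hausdorff measures of positive dimension.\<close>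

definition partition_preimages :: "real set" where
  "partition_preimages = {x \<in> {0..1}. \<exists>n. (f ^^ n) x \<in> a ` {..m}}"

lemma countable_partition_preimages: "countable partition_preimages"
proof -
  have inj: "inj_on f {a i<..<a (Suc i)}" if "i < m" for i
  proof (rule inj_onI)
    fix x y assume "x \<in> {a i<..<a (Suc i)}" "y \<in> {a i<..<a (Suc i)}" "f x = f y"
    then show "x = y" using f_expands[of x y] that by (force simp: same_branch_def)
  qed
  have "countable {x \<in> {0..1}. (f ^^ n) x \<in> a ` {..m}}" for n
  proof (induction n)
    case 0
    show ?case by (rule countable_subset[of _ "a ` {..m}"]) auto
  next
    case (Suc n)
    let ?D = "{x \<in> {0..1}. (f ^^ n) x \<in> a ` {..m}}"
    have "x \<in> a ` {..m} \<union> (\<Union>i<m. f -` ?D \<inter> {a i<..<a (Suc i)})"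
      if "x \<in> {0..1}" "(f ^^ Suc n) x \<in> a ` {..m}" for x
    proof (cases "x \<in> a ` {..m}")
      case False
      then obtain i where "i < m" "x \<in> {a i<..<a (Suc i)}" using branch_exists \<open>x \<in> {0..1}\<close> by blast
      moreover have "f x \<in> ?D" using that f_maps by (auto simp: funpow_swap1)
      ultimately show ?thesis by blast
    qed simp
    moreover have "countable (f -` ?D \<inter> {a i<..<a (Suc i)})" if "i < m" for i
    proof (rule countable_image_inj_on)
      show "countable (f ` (f -` ?D \<inter> {a i<..<a (Suc i)}))" by (rule countable_subset[OF _ Suc]) blast
      show "inj_on f (f -` ?D \<inter> {a i<..<a (Suc i)})" by (rule inj_on_subset[OF inj[OF that]]) blast
    qed
    then have "countable (a ` {..m} \<union> (\<Union>i<m. f -` ?D \<inter> {a i<..<a (Suc i)}))"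
      by (intro countable_Un countable_UN) (auto intro: countable_finite)
    ultimately show ?case by (elim countable_subset[rotated]) blast
  qed
  then have "countable (\<Union>n. {x \<in> {0..1}. (f ^^ n) x \<in> a ` {..m}})" by blast
  then show ?thesis by (rule countable_subset[rotated]) (auto simp: partition_preimages_def)
qed

lemma bdd_above_birkhoff:
  assumes "0 \<le> s"
  shows "bdd_above ((\<lambda>y. \<Sum>k<n. - s * \<psi> ((f ^^ k) y)) ` bowen_ball {0..1} f n x \<epsilon>)"
proof (rule bdd_aboveI2)
  fix y assume "y \<in> bowen_ball {0..1} f n x \<epsilon>"
  then show "(\<Sum>k<n. - s * \<psi> ((f ^^ k) y)) \<le> 0"
    using assms f_maps by (intro sum_nonpos) (auto simp: bowen_ball_def intro!: mult_nonneg_nonneg psi_nonneg funpow_in)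
qed

text \<open>Divide each Bowen ball of length \<open>n\<close> according to the branch of the \<open>(n - 1)\<close>-st iterate. By
  \<open>same_branch_backwards\<close> each of the at most \<open>m\<close> pieces has a single itinerary, so its diameter is at
  most \<open>exp (n \<eta> - S\<^sub>n \<psi>)\<close> at any of its points. The remaining points of \<open>Z\<close>
  belong to \<open>partition_preimages\<close> and are covered by singletons.\<close>

lemma hausdorff_premeasure_le_pressure_sum:
  assumes "0 < s" "0 \<le> \<eta>" "distortion_radius \<eta> \<rho>" "2 * \<epsilon> \<le> \<rho>" "(4 * exp \<Lambda> + 2) * \<epsilon> \<le> mesh" "0 < \<delta>"
    and Z: "Z \<subseteq> {0..1}"
  obtains N where "\<And>\<Gamma>. \<Gamma> \<in> bowen_covers {0..1} f Z \<epsilon> N \<Longrightarrow>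
    hausdorff_premeasure s \<delta> Z \<le> of_nat m * pressure_sum {0..1} f (\<lambda>x. - s * \<psi> x) \<epsilon> (- s * \<eta>) \<Gamma>"
proof -
  obtain N where N: "\<And>n x y. N \<le> n \<Longrightarrow> x \<in> {0..1} \<Longrightarrow> y \<in> {0..1}
      \<Longrightarrow> (\<And>i. i < n \<Longrightarrow> same_branch ((f ^^ i) x) ((f ^^ i) y)) \<Longrightarrow> \<bar>x - y\<bar> < \<delta>"
    using expansive[OF \<open>0 < \<delta>\<close>] by blast
  \<comment> \<open>Length \<open>0\<close> is excluded because the pieces are formed by the \<open>(n - 1)\<close>-st iterate.\<close>
  show ?thesis
  proof (rule that[of "max 1 N"])
    fix \<Gamma> assume \<Gamma>: "\<Gamma> \<in> bowen_covers {0..1} f Z \<epsilon> (max 1 N)"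
    define w where "w = (\<lambda>(x, n). ennreal (exp (- (- s * \<eta>) * real n
        + (SUP y\<in>bowen_ball {0..1} f n x \<epsilon>. \<Sum>k<n. - s * \<psi> ((f ^^ k) y)))))"
    define piece where "piece = (\<lambda>((x, n), j). {y \<in> bowen_ball {0..1} f n x \<epsilon>. (f ^^ (n - 1)) y \<in> {a j<..<a (Suc j)}})"
    define U where "U = case_sum piece (\<lambda>x. {x})"
    define I where "I = Inl ` (\<Gamma> \<times> {..<m}) \<union> Inr ` partition_preimages"
    have piece_close: "same_branch ((f ^^ i) y) ((f ^^ i) z)" "\<bar>(f ^^ i) y - (f ^^ i) z\<bar> < 2 * \<epsilon>"
      if "((x, n), j) \<in> \<Gamma> \<times> {..<m}" "y \<in> piece ((x, n), j)" "z \<in> piece ((x, n), j)" "i < n" for x n j y z i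
    proof -
      have close: "\<bar>(f ^^ i) y - (f ^^ i) z\<bar> < 2 * \<epsilon>" if "i < n" for i
      proof -
        have "dist ((f ^^ i) x) ((f ^^ i) y) < \<epsilon>" "dist ((f ^^ i) x) ((f ^^ i) z) < \<epsilon>"
          using \<open>y \<in> _\<close> \<open>z \<in> _\<close> \<open>i < n\<close> by (auto simp: piece_def bowen_ball_def)
        then show ?thesis by (auto simp: dist_real_def)
      qed
      show "\<bar>(f ^^ i) y - (f ^^ i) z\<bar> < 2 * \<epsilon>" using close \<open>i < n\<close> .
      have "same_branch ((f ^^ (n - 1)) y) ((f ^^ (n - 1)) z)"
        using that by (auto simp: piece_def same_branch_def)
      moreover have "y \<in> {0..1}" "z \<in> {0..1}" using that by (auto simp: piece_def bowen_ball_def)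
      ultimately show "same_branch ((f ^^ i) y) ((f ^^ i) z)"
        using same_branch_backwards[OF assms(5), of y z "n - 1" i] close \<open>i < n\<close> by simp
    qed
    have piece_in: "y \<in> {0..1}" if "y \<in> piece p" for y p
      using that by (auto simp: piece_def bowen_ball_def split: prod.splits)
    have U_Inl: "bounded (piece p) \<and> diameter (piece p) \<le> \<delta> \<and> ennreal (diameter (piece p) powr s) \<le> w (fst p)"
      if p: "p \<in> \<Gamma> \<times> {..<m}" for p
    proof -
      obtain x n j where p_eq: "p = ((x, n), j)" and n: "max 1 N \<le> n" "x \<in> {0..1}"
        using p \<Gamma> by (cases p) (auto simp: bowen_covers_def)
      \<comment> \<open>\<open>exp (s * b)\<close> is the weight of the ball in the pressure sum with \<open>r = - s * \<eta>\<close>.\<close>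
      define b where "b = n * \<eta> + (SUP y\<in>bowen_ball {0..1} f n x \<epsilon>. \<Sum>k<n. - s * \<psi> ((f ^^ k) y)) / s"
      have bounds: "\<bar>y - z\<bar> \<le> min \<delta> (exp b)" if yz: "y \<in> piece p" "z \<in> piece p" for y z
      proof -
        have "\<bar>y - z\<bar> < \<delta>"
          using N[of n y z] n piece_close(1)[of x n j y z] yz p piece_in unfolding p_eq by auto
        moreover have "\<bar>y - z\<bar> \<le> exp (n * \<eta> - birkhoff_sum n y)"
        proof (rule contraction_along_common_itinerary[OF assms(3)])
          fix i assume "i < n"
          then show "\<bar>(f ^^ i) y - (f ^^ i) z\<bar> < \<rho>" "same_branch ((f ^^ i) y) ((f ^^ i) z)"
            using piece_close[of x n j y z i] yz p assms(4) unfolding p_eq by auto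
        qed (use yz piece_in in auto)
        moreover have "(\<Sum>k<n. - s * \<psi> ((f ^^ k) y)) \<le> (SUP y\<in>bowen_ball {0..1} f n x \<epsilon>. \<Sum>k<n. - s * \<psi> ((f ^^ k) y))"
          using yz assms(1) by (intro cSUP_upper bdd_above_birkhoff) (auto simp: p_eq piece_def)
        then have "n * \<eta> - birkhoff_sum n y \<le> b"
          using assms(1) by (simp add: b_def field_simps sum_negf sum_distrib_left)
        ultimately show ?thesis by (simp add: min_def) (meson exp_le_cancel_iff order_trans)
      qed
      have diam: "diameter (piece p) \<le> min \<delta> (exp b)"
        using bounds assms(6) by (intro diameter_le) auto
      have bdd: "bounded (piece p)"
        by (rule bounded_subset[OF bounded_closed_interval[of 0 1]]) (use piece_in in blast)
      have "diameter (piece p) powr s \<le> exp b powr s"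
        using diam assms(1) by (intro powr_mono2 diameter_ge_0 bdd) auto
      also have "\<dots> = exp (- (- s * \<eta>) * real n
          + (SUP y\<in>bowen_ball {0..1} f n x \<epsilon>. \<Sum>k<n. - s * \<psi> ((f ^^ k) y)))"
        using assms(1) by (simp add: powr_def b_def field_simps)
      finally have "ennreal (diameter (piece p) powr s) \<le> w (fst p)"
        by (simp add: w_def p_eq ennreal_leI)
      then show ?thesis using diam bdd by simp
    qed
    have "hausdorff_premeasure s \<delta> Z \<le> (\<Sum>\<^sub>\<infinity>i\<in>I. ennreal (diameter (U i) powr s))"
    proof (rule hausdorff_premeasure_le_infsum)
      show "countable I"
        using \<Gamma> countable_partition_preimages by (auto simp: I_def bowen_covers_def)
      show "Z \<subseteq> (\<Union>i\<in>I. U i)"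
      proof
        fix y assume y: "y \<in> Z"
        show "y \<in> (\<Union>i\<in>I. U i)"
        proof (cases "y \<in> partition_preimages")
          case True
          then show ?thesis by (auto simp: I_def U_def)
        next
          case False
          obtain x n where xn: "(x, n) \<in> \<Gamma>" "y \<in> bowen_ball {0..1} f n x \<epsilon>"
            using y \<Gamma> by (auto simp: bowen_covers_def)
          have "(f ^^ (n - 1)) y \<in> {0..1}" "(f ^^ (n - 1)) y \<notin> a ` {..m}"
            using y Z False funpow_in[OF f_maps] by (auto simp: partition_preimages_def)
          then obtain j where "j < m" "(f ^^ (n - 1)) y \<in> {a j<..<a (Suc j)}" by (rule branch_exists)
          then have "y \<in> U (Inl ((x, n), j))" "Inl ((x, n), j) \<in> I"
            using xn by (auto simp: U_def I_def piece_def)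
          then show ?thesis by blast
        qed
      qed
      show "bounded (U i) \<and> diameter (U i) \<le> \<delta>" if "i \<in> I" for i
        using that U_Inl assms(6) by (auto simp: I_def U_def)
    qed (rule assms(6))
    also have "\<dots> \<le> (\<Sum>\<^sub>\<infinity>i\<in>Inl ` (\<Gamma> \<times> {..<m}). ennreal (diameter (U i) powr s))"
      using assms(1) by (intro infsum_mono_neutral) (auto simp: I_def U_def nonneg_summable_on_complete)
    also have "\<dots> \<le> (\<Sum>\<^sub>\<infinity>p\<in>\<Gamma> \<times> {..<m}. ennreal (diameter (piece p) powr s))"
      using infsum_image_le_ennreal[of "\<lambda>i. ennreal (diameter (U i) powr s)" Inl "\<Gamma> \<times> {..<m}"]
      by (simp add: U_def comp_def)
    also have "\<dots> \<le> of_nat m * infsum w \<Gamma>"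
    proof (rule infsum_ennreal_leI)
      fix F assume F: "finite F" "F \<subseteq> \<Gamma> \<times> {..<m}"
      have "(\<Sum>p\<in>F. ennreal (diameter (piece p) powr s)) \<le> (\<Sum>p\<in>F. w (fst p))"
        using F U_Inl by (intro sum_mono) auto
      also have "\<dots> \<le> (\<Sum>p\<in>fst ` F \<times> {..<m}. w (fst p))"
        using F by (intro sum_mono2) force+
      also have "\<dots> = (\<Sum>q\<in>fst ` F. \<Sum>j<m. w q)"
        by (subst sum.cartesian_product) (simp add: split_def)
      also have "\<dots> = of_nat m * (\<Sum>q\<in>fst ` F. w q)"
        by (simp add: sum_distrib_left)
      also have "\<dots> \<le> of_nat m * infsum w \<Gamma>"
        using F by (intro mult_left_mono sum_le_infsum_ennreal) auto
      finally show "(\<Sum>p\<in>F. ennreal (diameter (piece p) powr s)) \<le> of_nat m * infsum w \<Gamma>" .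
    qed
    finally show "hausdorff_premeasure s \<delta> Z
        \<le> of_nat m * pressure_sum {0..1} f (\<lambda>x. - s * \<psi> x) \<epsilon> (- s * \<eta>) \<Gamma>"
      by (simp add: pressure_sum_def w_def)
  qed
qed

section \<open>Iterating an interval up to a fixed length\<close>

text \<open>\<open>grows \<epsilon> n u v\<close>: the first \<open>n\<close> images of \<open>(u, v)\<close>, starting with the interval itself, are intervals shorter than \<open>\<epsilon>\<close>
  inside single branches, and the next one has length at least \<open>\<epsilon>\<close>. The images are described by their
  end points, for which the extended branches \<open>g i\<close> are needed.\<close>

fun grows :: "real \<Rightarrow> nat \<Rightarrow> real \<Rightarrow> real \<Rightarrow> bool" where
  "grows \<epsilon> 0 u v \<longleftrightarrow> \<epsilon> \<le> v - u"
| "grows \<epsilon> (Suc n) u v \<longleftrightarrow> u < v \<and> v - u < \<epsilon> \<and>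
     (\<exists>i<m. a i \<le> u \<and> v \<le> a (Suc i) \<and> grows \<epsilon> n (g i u) (g i v))"

lemma grows_less: "0 < \<epsilon> \<Longrightarrow> grows \<epsilon> n u v \<Longrightarrow> u < v"
  by (cases n) auto

lemma f_image_interval:
  assumes "i < m" "a i \<le> u" "u < v" "v \<le> a (Suc i)" and y: "y \<in> {g i u<..<g i v}"
  obtains x where "x \<in> {u<..<v}" "f x = y"
proof -
  obtain x where x: "u \<le> x" "x \<le> v" "g i x = y" using g_ivt[of i u v y] assms by auto
  then have "x \<in> {u<..<v}" using y by (auto simp: less_le)
  then show ?thesis using that[of x] x(3) f_eq_g[of i x] assms by auto
qed

lemma f_maps_interval:
  assumes "i < m" "a i \<le> u" "v \<le> a (Suc i)" "x \<in> {u<..<v}"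
  shows "x \<in> {a i<..<a (Suc i)}" "f x \<in> {g i u<..<g i v}"
  using assms g_strict[of i u x] g_strict[of i x v] f_eq_g[of i x] by auto

lemma grows_time_bound:
  assumes "0 < \<epsilon>" "grows \<epsilon> n u v" shows "\<epsilon> \<le> exp \<Lambda> ^ n * (v - u)"
  using assms(2)
proof (induction n arbitrary: u v)
  case (Suc n)
  then obtain i where i: "i < m" "a i \<le> u" "u < v" "v \<le> a (Suc i)" "grows \<epsilon> n (g i u) (g i v)" by auto
  have "\<epsilon> \<le> exp \<Lambda> ^ n * (g i v - g i u)" using Suc.IH[OF i(5)] .
  also have "\<dots> \<le> exp \<Lambda> ^ n * (exp \<Lambda> * (v - u))"
    using g_lipschitz[of i u v] i by (intro mult_left_mono) auto
  finally show ?case by (simp add: algebra_simps)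
qed simp

text \<open>A short interval with a partition point as an end lies in one branch, and its image again has a
  partition point as an end. So such an interval is never cut; by \<open>growth\<close> it reaches length
  \<open>\<epsilon>\<close> after finitely many steps.\<close>

lemma anchored_grows:
  assumes \<epsilon>: "0 < \<epsilon>" "\<epsilon> \<le> mesh" and "0 \<le> u" "u < v" "v \<le> 1" and "u \<in> a ` {..m} \<or> v \<in> a ` {..m}"
  shows "\<exists>n. grows \<epsilon> n u v"
proof -
  define \<delta> where "\<delta> = v - u"
  obtain c where c: "0 < c" and grow: "\<And>i u v. i < m \<Longrightarrow> a i \<le> u \<Longrightarrow> u + \<delta> \<le> v \<Longrightarrow> v \<le> a (Suc i)
      \<Longrightarrow> v - u + c \<le> g i v - g i u"
    using growth[of \<delta>] \<open>u < v\<close> by (auto simp: \<delta>_def)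
  have "\<exists>n. grows \<epsilon> n u v" if "0 \<le> u" "v \<le> 1" "\<delta> \<le> v - u" "u \<in> a ` {..m} \<or> v \<in> a ` {..m}" "1 - (v - u) < k * c"
    for k :: nat and u v
    using that
  proof (induction k arbitrary: u v)
    case (Suc k)
    have "u < v" using Suc.prems(3) assms(4) by (simp add: \<delta>_def)
    show ?case
    proof (cases "\<epsilon> \<le> v - u")
      case True
      then have "grows \<epsilon> 0 u v" by simp
      then show ?thesis by blast
    next
      case False
      have "\<exists>i<m. a i \<le> u \<and> v \<le> a (Suc i) \<and> (u = a i \<or> v = a (Suc i))"
        using Suc.prems(4)
      proof
        assume "u \<in> a ` {..m}"
        then obtain i where i: "i \<le> m" "u = a i" by auto
        with \<open>u < v\<close> Suc.prems(2) a_m have "i < m" by (cases "i = m") auto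
        then show ?thesis using i mesh_le[of i] False \<epsilon> by force
      next
        assume "v \<in> a ` {..m}"
        then obtain i where i: "i \<le> m" "v = a i" by auto
        with \<open>u < v\<close> Suc.prems(1) a_0 have "i \<noteq> 0" by (cases "i = 0") auto
        then obtain j where "i = Suc j" by (cases i) auto
        then show ?thesis using i mesh_le[of j] False \<epsilon> by force
      qed
      then obtain i where i: "i < m" "a i \<le> u" "v \<le> a (Suc i)" "u = a i \<or> v = a (Suc i)" by blast
      have gr: "v - u + c \<le> g i v - g i u" using grow[of i u v] i Suc.prems(3) by simp
      have "g i u \<in> {0..1}" "g i v \<in> {0..1}" using g_in[of i] i \<open>u < v\<close> by auto
      moreover have "g i u \<in> a ` {..m} \<or> g i v \<in> a ` {..m}" using i g_left g_right by auto
      ultimately have "\<exists>n. grows \<epsilon> n (g i u) (g i v)"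
        using gr c Suc.prems(3,5) by (intro Suc.IH) (auto simp: algebra_simps)
      then obtain n where "grows \<epsilon> n (g i u) (g i v)" by blast
      then have "grows \<epsilon> (Suc n) u v" using i \<open>u < v\<close> False by auto
      then show ?thesis by blast
    qed
  qed simp
  note main = this
  obtain k :: nat where "1 < k * c" using ex_less_of_nat_mult[OF c] by blast
  then show ?thesis using assms by (intro main[of u v k]) (auto simp: \<delta>_def)
qed

text \<open>Iterate the interval until it becomes long or a partition point cuts it. In the second case both
  parts are anchored at that partition point and \<open>anchored_grows\<close> applies to them; pulling back through
  the branches followed so far yields two subintervals of \<open>(u, v)\<close>. In the first case one interval serves twice. The
  finite set consists of the preimage of the cutting point.\<close>

lemma interval_splits_in_two:
  assumes \<epsilon>: "0 < \<epsilon>" "\<epsilon> \<le> mesh" and "0 \<le> u" "u < v" "v \<le> 1"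
  shows "\<exists>n u1 v1 n' u2 v2 F. grows \<epsilon> n u1 v1 \<and> grows \<epsilon> n' u2 v2 \<and> u \<le> u1 \<and> v1 \<le> v \<and> u \<le> u2 \<and> v2 \<le> v
    \<and> finite F \<and> {u<..<v} \<subseteq> {u1<..<v1} \<union> {u2<..<v2} \<union> F"
    (is "?split u v")
proof -
  define \<delta> where "\<delta> = v - u"
  obtain c where c: "0 < c" and grow: "\<And>i u v. i < m \<Longrightarrow> a i \<le> u \<Longrightarrow> u + \<delta> \<le> v \<Longrightarrow> v \<le> a (Suc i)
      \<Longrightarrow> v - u + c \<le> g i v - g i u"
    using growth[of \<delta>] \<open>u < v\<close> by (auto simp: \<delta>_def)
  have splitI: "?split u v" if "grows \<epsilon> n u1 v1" "grows \<epsilon> n' u2 v2" "u \<le> u1" "v1 \<le> v" "u \<le> u2" "v2 \<le> v"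
    "finite F" "{u<..<v} \<subseteq> {u1<..<v1} \<union> {u2<..<v2} \<union> F" for n u1 v1 n' u2 v2 u v F
    using that by blast
  have "?split u v" if "0 \<le> u" "v \<le> 1" "\<delta> \<le> v - u" "1 - (v - u) < k * c" for k :: nat and u v
    using that
  proof (induction k arbitrary: u v)
    case (Suc k)
    have "u < v" using Suc.prems(3) assms(4) by (simp add: \<delta>_def)
    obtain i where i: "i < m" "a i \<le> u" "u < a (Suc i)"
      using left_end_exists[of u] Suc.prems \<open>u < v\<close> by auto
    consider "\<epsilon> \<le> v - u" | "v - u < \<epsilon>" "v \<le> a (Suc i)" | "a (Suc i) < v" by linarith
    then show ?case
    proof cases
      case 1
      then have "grows \<epsilon> 0 u v" by simp
      then show ?thesis
        using splitI[of 0 u v 0 u v u v "{}"] by auto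
    next
      case 2
      have "v - u + c \<le> g i v - g i u" using grow[of i u v] i 2 Suc.prems(3) by simp
      moreover have "g i u \<in> {0..1}" "g i v \<in> {0..1}" using g_in[of i] i 2 \<open>u < v\<close> by auto
      ultimately have "?split (g i u) (g i v)"
        using c Suc.prems(3,4) by (intro Suc.IH) (auto simp: algebra_simps)
      then obtain n u1 v1 n' u2 v2 F where IH: "grows \<epsilon> n u1 v1" "grows \<epsilon> n' u2 v2"
        "g i u \<le> u1" "v1 \<le> g i v" "g i u \<le> u2" "v2 \<le> g i v" "finite F"
        "{g i u<..<g i v} \<subseteq> {u1<..<v1} \<union> {u2<..<v2} \<union> F" by blast
      have pull: "\<exists>p q. grows \<epsilon> (Suc n) p q \<and> u \<le> p \<and> q \<le> v \<and> g i p = u' \<and> g i q = v'"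
 if image: "grows \<epsilon> n u' v'" "g i u \<le> u'" "v' \<le> g i v" for n u' v'
      proof -
        have "u' < v'" using grows_less[OF \<epsilon>(1) image(1)] .
        obtain p where p: "u \<le> p" "p \<le> v" "g i p = u'"
          by (rule g_ivt[of i u v u']) (use i 2 \<open>u < v\<close> \<open>u' < v'\<close> image in auto)
        obtain q where q: "u \<le> q" "q \<le> v" "g i q = v'"
          by (rule g_ivt[of i u v v']) (use i 2 \<open>u < v\<close> \<open>u' < v'\<close> image in auto)
        have "p < q" using g_less_iff[of i p q] p q i 2 \<open>u' < v'\<close> by auto
        then have "grows \<epsilon> (Suc n) p q" using p q i 2 image by auto
        then show ?thesis using p q by blast
      qed
      obtain p q where pq: "grows \<epsilon> (Suc n) p q" "u \<le> p" "q \<le> v" "g i p = u1" "g i q = v1"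
        using pull[OF IH(1,3,4)] by blast
      obtain p' q' where pq': "grows \<epsilon> (Suc n') p' q'" "u \<le> p'" "q' \<le> v" "g i p' = u2" "g i q' = v2"
        using pull[OF IH(2,5,6)] by blast
      have "finite (f -` F \<inter> {u<..<v})"
      proof (rule finite_vimage_IntI[OF IH(7)], rule inj_onI)
        fix x y assume "x \<in> {u<..<v}" "y \<in> {u<..<v}" "f x = f y"
        moreover from this have "same_branch x y"
          using f_maps_interval(1)[of i u v] i 2 by (auto simp: same_branch_def)
        ultimately show "x = y" using f_expands[of x y] by simp
      qed
      moreover have "{u<..<v} \<subseteq> {p<..<q} \<union> {p'<..<q'} \<union> (f -` F \<inter> {u<..<v})"
      proof
        fix x assume x: "x \<in> {u<..<v}"
        have fx: "f x = g i x" "f x \<in> {g i u<..<g i v}"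
          using f_maps_interval[of i u v x] f_eq_g[of i x] i 2 x by auto
        have inside: "x \<in> {r<..<t}" if "f x \<in> {g i r<..<g i t}" "u \<le> r" "r < t" "t \<le> v" for r t
          using that g_less_iff[of i r x] g_less_iff[of i x t] fx(1) i 2 x by auto
        have "p < q" "p' < q'" using pq(1) pq'(1) by auto
        consider "f x \<in> {u1<..<v1}" | "f x \<in> {u2<..<v2}" | "f x \<in> F" using IH(8) fx(2) by blast
        then show "x \<in> {p<..<q} \<union> {p'<..<q'} \<union> (f -` F \<inter> {u<..<v})"
        proof cases
          case 1
          then show ?thesis using inside[of p q] pq \<open>p < q\<close> by simp
        next
          case 2
          then show ?thesis using inside[of p' q'] pq' \<open>p' < q'\<close> by simp
        next
          case 3
          then show ?thesis using x by simp
        qed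
      qed
      ultimately show ?thesis by (intro splitI[OF pq(1) pq'(1)] pq(2,3) pq'(2,3))
    next
      case 3
      have e: "a (Suc i) \<in> a ` {..m}" using i by simp
      have "\<exists>n. grows \<epsilon> n u (a (Suc i))" "\<exists>n. grows \<epsilon> n (a (Suc i)) v"
        using i 3 Suc.prems e a_in[of "Suc i"] by (intro anchored_grows[OF \<epsilon>]; simp)+
      then obtain n n' where "grows \<epsilon> n u (a (Suc i))" "grows \<epsilon> n' (a (Suc i)) v" by blast
      then show ?thesis using i 3 by (intro splitI[of n _ _ n' _ _ _ _ "{a (Suc i)}"]) auto
    qed
  qed simp
  note main = this
  obtain k :: nat where "1 < k * c" using ex_less_of_nat_mult[OF c] by blast
  then show ?thesis using assms by (intro main[of u v k]) (auto simp: \<delta>_def)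
qed

text \<open>The image of \<open>(u, v)\<close> at the last time before it becomes long is shorter than \<open>\<epsilon>\<close> and lies in
  one branch. That branch contains a point at distance at least \<open>\<epsilon>\<close> from its ends and less than \<open>\<epsilon>\<close> from the
  whole image; by \<open>branch_image_covers\<close> this point can be pulled back along the itinerary of
  \<open>(u, v)\<close>, and expansion keeps the distances below \<open>\<epsilon>\<close>.\<close>

lemma central_point_shadows_interval:
  assumes \<epsilon>: "0 < \<epsilon>" "2 * \<epsilon> \<le> mesh" and "grows \<epsilon> (Suc n) u v"
  shows "\<exists>z\<in>{0..1}. \<exists>j<m. a j + \<epsilon> \<le> (f ^^ n) z \<and> (f ^^ n) z \<le> a (Suc j) - \<epsilon> \<and>
    (\<forall>y\<in>{u<..<v}. \<forall>i\<le>n. same_branch ((f ^^ i) z) ((f ^^ i) y) \<and> \<bar>(f ^^ i) z - (f ^^ i) y\<bar> < \<epsilon>)"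
  using assms(3)
proof (induction n arbitrary: u v)
  case 0
  then obtain j where j: "j < m" "a j \<le> u" "v \<le> a (Suc j)" "u < v" "v - u < \<epsilon>" by auto
  \<comment> \<open>the midpoint, moved away from the ends of the branch where necessary\<close>
  define z where "z = max (a j + \<epsilon>) (min (a (Suc j) - \<epsilon>) ((u + v) / 2))"
  have z: "a j + \<epsilon> \<le> z" "z \<le> a (Suc j) - \<epsilon>" using mesh_le[OF j(1)] \<epsilon> by (auto simp: z_def)
  have "\<bar>z - y\<bar> < \<epsilon>" if "y \<in> {u<..<v}" for y
    using that j \<epsilon> mesh_le[OF j(1)] unfolding z_def max_def min_def by (auto simp: abs_less_iff field_simps)
  moreover have "same_branch z y" if "y \<in> {u<..<v}" for y
    using that j z \<epsilon> by (auto simp: same_branch_def)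
  moreover have "z \<in> {0..1}" using z \<epsilon> branch_subset[OF j(1)] j by auto
  ultimately show ?case using z j(1) by (intro bexI[of _ z] exI[of _ j]) auto
next
  case (Suc n)
  then obtain i where i: "i < m" "a i \<le> u" "v \<le> a (Suc i)" "u < v" "grows \<epsilon> (Suc n) (g i u) (g i v)"
    by (auto simp del: grows.simps simp: grows.simps(2)[of \<epsilon> "Suc n"])
  obtain z' j where z': "z' \<in> {0..1}" "j < m" "a j + \<epsilon> \<le> (f ^^ n) z'" "(f ^^ n) z' \<le> a (Suc j) - \<epsilon>"
    and shadow: "\<And>y k. y \<in> {g i u<..<g i v} \<Longrightarrow> k \<le> n \<Longrightarrow>
      same_branch ((f ^^ k) z') ((f ^^ k) y) \<and> \<bar>(f ^^ k) z' - (f ^^ k) y\<bar> < \<epsilon>"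
    using Suc.IH[OF i(5)] by blast
  define x where "x = (u + v) / 2"
  have x: "x \<in> {u<..<v}" using i by (auto simp: x_def)
  obtain z where z: "z \<in> {a i<..<a (Suc i)}" "f z = z'"
  proof (rule branch_image_covers)
    show "x \<in> {a i<..<a (Suc i)}" "same_branch (f x) z'"
      using f_maps_interval[of i u v x] i x shadow[of "f x" 0] by (auto intro: same_branch_sym)
  qed (rule i(1))
  have "same_branch ((f ^^ k) z) ((f ^^ k) y) \<and> \<bar>(f ^^ k) z - (f ^^ k) y\<bar> < \<epsilon>"
    if y: "y \<in> {u<..<v}" and "k \<le> Suc n" for y k
  proof -
    have fy: "y \<in> {a i<..<a (Suc i)}" "f y \<in> {g i u<..<g i v}" using f_maps_interval[of i u v y] i y by auto
    show ?thesis
    proof (cases k)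
      case 0
      have "same_branch z y" using fy z i by (auto simp: same_branch_def)
      then show ?thesis using f_expands[of z y] shadow[OF fy(2), of 0] z 0 by simp
    next
      case (Suc l)
      then show ?thesis using shadow[OF fy(2), of l] z \<open>k \<le> Suc n\<close> by (simp add: funpow_swap1)
    qed
  qed
  moreover have "z \<in> {0..1}" using z branch_subset[OF i(1)] by auto
  ultimately show ?case using z z' by (intro bexI[of _ z] exI[of _ j]) (auto simp: funpow_swap1)
qed

text \<open>The mean value theorem at each step; the point \<open>w\<close> need not lie in the interval but only follow it
  within the distortion radius.\<close>

lemma length_lower_bound:
  assumes "0 < \<epsilon>" "distortion_radius \<eta> \<rho>" "grows \<epsilon> n u v" and "w \<in> {0..1}"
    and "\<And>y i. y \<in> {u<..<v} \<Longrightarrow> i < n \<Longrightarrow> same_branch ((f ^^ i) w) ((f ^^ i) y)"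
    and "\<And>y i. y \<in> {u<..<v} \<Longrightarrow> i < n \<Longrightarrow> \<bar>(f ^^ i) w - (f ^^ i) y\<bar> < \<rho>"
  shows "\<epsilon> \<le> exp (birkhoff_sum n w + n * \<eta>) * (v - u)"
  using assms(3-)
proof (induction n arbitrary: u v w)
  case (Suc n)
  then obtain i where i: "i < m" "a i \<le> u" "v \<le> a (Suc i)" "u < v" "grows \<epsilon> n (g i u) (g i v)" by auto
  obtain \<xi> where \<xi>: "\<xi> \<in> {u<..<v}" "g i v - g i u = exp (\<psi> \<xi>) * (v - u)"
    using g_mvt[of i u v] i by auto
  have "\<psi> \<xi> \<le> \<psi> w + \<eta>"
    using assms(2) Suc.prems(3)[OF \<xi>(1), of 0] Suc.prems(4)[OF \<xi>(1), of 0]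
    by (force simp: distortion_radius_def)
  have "f w \<in> {0..1}" using Suc.prems f_maps by auto
  then have "\<epsilon> \<le> exp (birkhoff_sum n (f w) + n * \<eta>) * (g i v - g i u)"
  proof (rule Suc.IH[OF i(5)])
    fix y k assume "y \<in> {g i u<..<g i v}" "k < n"
    moreover from this obtain x where "x \<in> {u<..<v}" "f x = y" using f_image_interval[of i u v y] i by auto
    ultimately show "same_branch ((f ^^ k) (f w)) ((f ^^ k) y)" "\<bar>(f ^^ k) (f w) - (f ^^ k) y\<bar> < \<rho>"
      using Suc.prems(3)[of x "Suc k"] Suc.prems(4)[of x "Suc k"] by (auto simp: funpow_swap1)
  qed
  also have "\<dots> \<le> exp (birkhoff_sum n (f w) + n * \<eta>) * (exp (\<psi> w + \<eta>) * (v - u))"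
    unfolding \<xi>(2) using \<open>\<psi> \<xi> \<le> \<psi> w + \<eta>\<close> i by (intro mult_left_mono mult_right_mono) auto
  also have "\<dots> = exp (birkhoff_sum (Suc n) w + Suc n * \<eta>) * (v - u)"
    by (simp add: birkhoff_sum_Suc algebra_simps flip: exp_add del: sum.lessThan_Suc)
  finally show ?case .
qed simp

lemma twice_scale_le_mesh:
  assumes "0 < \<epsilon>" "(4 * exp \<Lambda> + 2) * \<epsilon> \<le> mesh" shows "2 * \<epsilon> \<le> mesh"
proof -
  have "0 \<le> 4 * exp \<Lambda> * \<epsilon>" using assms(1) by simp
  then show ?thesis using assms(2) by (simp add: algebra_simps)
qed

text \<open>The Bowen ball of length \<open>n\<close> around the point of \<open>central_point_shadows_interval\<close> contains the
  interval. Since its final image stays inside one branch, all its points share the itinerary of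
  the interval, hence \<open>length_lower_bound\<close> bounds \<open>- S\<^sub>n \<psi>\<close> on the entire ball. The choice
  \<open>r = s \<eta>\<close> cancels the distortion.\<close>

lemma pressure_premeasure_growing_interval_le:
  assumes "0 < s" "0 < \<epsilon>" "0 < \<eta>" "distortion_radius \<eta> \<rho>" "2 * \<epsilon> \<le> \<rho>" "(4 * exp \<Lambda> + 2) * \<epsilon> \<le> mesh"
    and "grows \<epsilon> n u v" "N \<le> n" "n \<noteq> 0"
  shows "pressure_premeasure {0..1} f (\<lambda>x. - s * \<psi> x) {u<..<v} (s * \<eta>) \<epsilon> N \<le> ennreal (((v - u) / \<epsilon>) powr s)"
proof -
  obtain l where l: "n = Suc l" using assms(9) by (cases n) auto
  obtain z j where z: "z \<in> {0..1}" "j < m" "a j + \<epsilon> \<le> (f ^^ l) z" "(f ^^ l) z \<le> a (Suc j) - \<epsilon>"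
    and shadow: "\<And>y i. y \<in> {u<..<v} \<Longrightarrow> i \<le> l \<Longrightarrow>
      same_branch ((f ^^ i) z) ((f ^^ i) y) \<and> \<bar>(f ^^ i) z - (f ^^ i) y\<bar> < \<epsilon>"
    using central_point_shadows_interval[OF assms(2) twice_scale_le_mesh[OF assms(2,6)] assms(7)[unfolded l]] by blast
  have "u < v" using grows_less assms by blast
  let ?B = "bowen_ball {0..1} f n z \<epsilon>"
  have bound: "(\<Sum>k<n. - s * \<psi> ((f ^^ k) w)) \<le> s * ln ((v - u) / \<epsilon>) + n * (s * \<eta>)" if w: "w \<in> ?B" for w
  proof -
    have w_close: "w \<in> {0..1}" "\<And>i. i \<le> l \<Longrightarrow> \<bar>(f ^^ i) z - (f ^^ i) w\<bar> < \<epsilon>"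
      using w by (auto simp: bowen_ball_def l dist_real_def)
    have "same_branch ((f ^^ l) z) ((f ^^ l) w)"
      using w_close(2)[of l] z \<open>0 < \<epsilon>\<close> by (auto simp: same_branch_def abs_less_iff intro!: exI[of _ j])
    note last = this
    have itin: "same_branch ((f ^^ i) z) ((f ^^ i) w)" if "i \<le> l" for i
    proof (rule same_branch_backwards[OF assms(6) z(1) w_close(1), of l])
      show "\<bar>(f ^^ k) z - (f ^^ k) w\<bar> < 2 * \<epsilon>" if "k \<le> l" for k
        using w_close(2)[OF that] assms(2) by simp
    qed (use last that in simp_all)
    have "\<epsilon> \<le> exp (birkhoff_sum n w + n * \<eta>) * (v - u)"
    proof (rule length_lower_bound[OF assms(2,4,7) w_close(1)])
      fix y i assume "y \<in> {u<..<v}" "i < n"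
      then show "same_branch ((f ^^ i) w) ((f ^^ i) y)"
        using same_branch_trans[OF same_branch_sym[OF itin[of i]]] shadow by (simp add: l)
      show "\<bar>(f ^^ i) w - (f ^^ i) y\<bar> < \<rho>"
        using w_close(2)[of i] shadow[of y i] \<open>y \<in> _\<close> \<open>i < n\<close> assms(5) by (auto simp: l)
    qed
    then have "ln \<epsilon> \<le> ln (exp (birkhoff_sum n w + n * \<eta>) * (v - u))" using assms(2) by simp
    also have "\<dots> = birkhoff_sum n w + n * \<eta> + ln (v - u)" using \<open>u < v\<close> by (subst ln_mult) auto
    finally have "- birkhoff_sum n w \<le> ln ((v - u) / \<epsilon>) + n * \<eta>"
      using \<open>u < v\<close> assms(2) by (simp add: ln_div)
    then have "s * (- birkhoff_sum n w) \<le> s * (ln ((v - u) / \<epsilon>) + n * \<eta>)"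
      using assms(1) by (intro mult_left_mono) auto
    then show ?thesis by (simp add: sum_distrib_left sum_negf algebra_simps)
  qed
  have "{u<..<v} \<subseteq> ?B"
  proof
    fix y assume "y \<in> {u<..<v}"
    moreover have "y \<in> {0..1}"
    proof -
      have "same_branch z y" using shadow[OF \<open>y \<in> _\<close>, of 0] by simp
      then obtain i where "i < m" "y \<in> {a i<..<a (Suc i)}" by (auto simp: same_branch_def)
      then show ?thesis using branch_subset[of i] by auto
    qed
    ultimately show "y \<in> ?B" using shadow by (auto simp: bowen_ball_def dist_real_def l)
  qed
  then have "pressure_premeasure {0..1} f (\<lambda>x. - s * \<psi> x) {u<..<v} (s * \<eta>) \<epsilon> N
      \<le> ennreal (exp (- (s * \<eta>) * real n + (SUP w\<in>?B. \<Sum>k<n. - s * \<psi> ((f ^^ k) w))))"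
    using z(1) assms(8) by (rule pressure_premeasure_single_ball_le)
  also have "\<dots> \<le> ennreal (exp (s * ln ((v - u) / \<epsilon>)))"
  proof -
    have "?B \<noteq> {}" using centre_in_bowen_ball[OF z(1) assms(2)] by blast
    then have "(SUP w\<in>?B. \<Sum>k<n. - s * \<psi> ((f ^^ k) w)) \<le> s * ln ((v - u) / \<epsilon>) + n * (s * \<eta>)"
      using bound by (rule cSUP_least)
    then show ?thesis by (intro ennreal_leI) (simp add: algebra_simps)
  qed
  also have "exp (s * ln ((v - u) / \<epsilon>)) = ((v - u) / \<epsilon>) powr s"
    using \<open>u < v\<close> assms(2) by (simp add: powr_def)
  finally show ?thesis .
qed

text \<open>The convex hull of \<open>V\<close> consists of two growing intervals and finitely many points. The hypothesis on
  \<open>\<delta>\<close> makes sure that the intervals need at least \<open>N\<close> steps to reach length \<open>\<epsilon>\<close>.\<close>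

lemma pressure_premeasure_small_set_le:
  assumes "0 < s" "0 < \<epsilon>" "0 < \<eta>" "distortion_radius \<eta> \<rho>" "2 * \<epsilon> \<le> \<rho>" "(4 * exp \<Lambda> + 2) * \<epsilon> \<le> mesh"
    and \<delta>: "exp \<Lambda> ^ N * \<delta> < \<epsilon>"
    and V: "V \<subseteq> {0..1}" "diameter V \<le> \<delta>"
  shows "pressure_premeasure {0..1} f (\<lambda>x. - s * \<psi> x) V (s * \<eta>) \<epsilon> N
     \<le> ennreal (2 / \<epsilon> powr s) * ennreal (diameter V powr s)" (is "?p V \<le> _")
proof -
  have "0 \<le> \<psi> (1 / 2)" "\<psi> (1 / 2) \<le> \<Lambda>" by (auto intro: psi_nonneg psi_le)
  then have "0 \<le> \<Lambda>" by simp
  have null: "?p W = 0" if "countable W" "W \<subseteq> {0..1}" for W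
    using that assms(1-3) psi_nonneg
    by (intro pressure_premeasure_countable_eq_0 f_maps) (auto simp: mult_nonneg_nonneg)
  have bdd: "bounded V" using V by (auto intro: bounded_subset[OF bounded_closed_interval[of 0 1]])
  have dist_le: "x - y \<le> diameter V" if "x \<in> V" "y \<in> V" for x y
    using diameter_bounded_bound[OF bdd that] by (simp add: dist_real_def)
  have bd: "bdd_above V" "bdd_below V" using V by (auto intro: bdd_above_mono bdd_below_mono)
  show ?thesis
  proof (cases "V = {} \<or> Inf V = Sup V")
    case True
    have "V \<subseteq> {Sup V}"
    proof
      fix x assume "x \<in> V"
      then have "Inf V \<le> x" "x \<le> Sup V" using bd by (auto intro: cInf_lower cSup_upper)
      then show "x \<in> {Sup V}" using True \<open>x \<in> V\<close> by auto
    qed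
    then have "countable V" by (rule countable_subset) simp
    then show ?thesis using null V by simp
  next
    case False
    define u v where "u = Inf V" and "v = Sup V"
    have V_uv: "V \<subseteq> {u..v}" using bd by (auto simp: u_def v_def intro: cInf_lower cSup_upper)
    have "u < v" using False V_uv by (auto simp: u_def[symmetric] v_def[symmetric])
    have "v - u \<le> diameter V"
    proof -
      have "Sup V \<le> diameter V + y" if "y \<in> V" for y
        using False dist_le[OF _ that] by (intro cSup_least) (auto simp: algebra_simps)
      then have "Sup V - diameter V \<le> Inf V" using False by (intro cInf_greatest) (auto simp: algebra_simps)
      then show ?thesis by (simp add: u_def v_def)
    qed
    have "0 \<le> u" "v \<le> 1" using False V by (auto simp: u_def v_def intro!: cInf_greatest cSup_least)
    have "0 < \<delta>" using \<open>u < v\<close> \<open>v - u \<le> diameter V\<close> V by simp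
    have "1 * \<delta> \<le> exp \<Lambda> ^ N * \<delta>"
      using \<open>0 \<le> \<Lambda>\<close> \<open>0 < \<delta>\<close> by (intro mult_right_mono one_le_power) auto
    then have "\<delta> < \<epsilon>" using \<delta> by simp
    have "\<epsilon> \<le> mesh" using twice_scale_le_mesh[OF assms(2,6)] assms(2) by simp
    from interval_splits_in_two[OF assms(2) this \<open>0 \<le> u\<close> \<open>u < v\<close> \<open>v \<le> 1\<close>]
    obtain n u1 v1 n' u2 v2 F where split: "grows \<epsilon> n u1 v1" "grows \<epsilon> n' u2 v2"
      "u \<le> u1" "v1 \<le> v" "u \<le> u2" "v2 \<le> v" "finite F" "{u<..<v} \<subseteq> {u1<..<v1} \<union> {u2<..<v2} \<union> F"
      by blast
    have piece: "?p {p<..<q} \<le> ennreal ((diameter V / \<epsilon>) powr s)"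
      if "grows \<epsilon> k p q" "u \<le> p" "q \<le> v" for k p q
    proof -
      have "p < q" using grows_less[OF assms(2) that(1)] .
      have "q - p \<le> \<delta>" using that \<open>v - u \<le> diameter V\<close> V by simp
      have "N \<le> k"
      proof (rule ccontr)
        assume "\<not> N \<le> k"
        then have "exp \<Lambda> ^ k * (q - p) \<le> exp \<Lambda> ^ N * \<delta>"
          using \<open>0 \<le> \<Lambda>\<close> \<open>q - p \<le> \<delta>\<close> \<open>p < q\<close> by (intro mult_mono power_increasing) auto
        then show False using grows_time_bound[OF assms(2) that(1)] \<delta> by simp
      qed
      moreover have "k \<noteq> 0" using that(1) \<open>q - p \<le> \<delta>\<close> \<open>\<delta> < \<epsilon>\<close> by (cases k) auto
      ultimately have "?p {p<..<q} \<le> ennreal (((q - p) / \<epsilon>) powr s)"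
        by (intro pressure_premeasure_growing_interval_le[OF assms(1-6) that(1)])
      also have "\<dots> \<le> ennreal ((diameter V / \<epsilon>) powr s)"
        using that \<open>v - u \<le> diameter V\<close> assms(1,2) \<open>p < q\<close>
        by (intro ennreal_leI powr_mono2 divide_right_mono) auto
      finally show ?thesis .
    qed
    \<comment> \<open>\<open>V\<close> may contain the end points of its hull.\<close>
    define W where "W = (F \<union> {u, v}) \<inter> {0..1}"
    have "V \<subseteq> ({u1<..<v1} \<union> {u2<..<v2}) \<union> W"
    proof
      fix x assume "x \<in> V"
      then have "x \<in> {0..1}" "x \<in> {u..v}" using V V_uv by blast+
      then consider "x \<in> {u<..<v}" | "x \<in> {u, v}" by force
      then show "x \<in> ({u1<..<v1} \<union> {u2<..<v2}) \<union> W"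
        using split(8) \<open>x \<in> {0..1}\<close> by cases (auto simp: W_def)
    qed
    then have "?p V \<le> ?p (({u1<..<v1} \<union> {u2<..<v2}) \<union> W)" by (rule pressure_premeasure_mono)
    also have "\<dots> \<le> ?p ({u1<..<v1} \<union> {u2<..<v2}) + ?p W" by (rule pressure_premeasure_Un_le)
    also have "?p W = 0" using split(7) by (intro null) (auto simp: W_def intro: countable_finite)
    also have "?p ({u1<..<v1} \<union> {u2<..<v2}) + 0 \<le> ?p {u1<..<v1} + ?p {u2<..<v2}"
      using pressure_premeasure_Un_le by simp
    also have "\<dots> \<le> ennreal ((diameter V / \<epsilon>) powr s) + ennreal ((diameter V / \<epsilon>) powr s)"
      using split by (intro add_mono piece) auto
    also have "\<dots> = ennreal (2 / \<epsilon> powr s) * ennreal (diameter V powr s)"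
      using assms(2) diameter_ge_0[OF bdd]
      by (simp add: powr_divide flip: ennreal_plus ennreal_mult)
    finally show ?thesis .
  qed
qed

section \<open>The sign of the pressure and the vanishing of the Hausdorff measure\<close>

text \<open>By \<open>pressure_premeasure_small_set_le\<close> and countable subadditivity, the pressure pre-measure is at most
  a constant multiple of the Hausdorff pre-measure at a sufficiently small scale \<open>\<delta>\<close>.\<close>

lemma pressure_premeasure_eq_0:
  assumes "0 < s" "0 < \<epsilon>" "0 < \<eta>" "distortion_radius \<eta> \<rho>" "2 * \<epsilon> \<le> \<rho>" "(4 * exp \<Lambda> + 2) * \<epsilon> \<le> mesh"
    and Z: "Z \<subseteq> {0..1}" and null: "hausdorff_measure s Z = 0"
  shows "pressure_premeasure {0..1} f (\<lambda>x. - s * \<psi> x) Z (s * \<eta>) \<epsilon> N = 0" (is "?p Z = 0")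
proof -
  \<comment> \<open>Lengths grow by a factor of at most \<open>exp \<Lambda>\<close> per step, so sets of this size stay below \<open>\<epsilon>\<close> for \<open>N\<close> steps.\<close>
  define \<delta> where "\<delta> = \<epsilon> / exp \<Lambda> ^ N / 2"
  have \<delta>: "0 < \<delta>" "exp \<Lambda> ^ N * \<delta> < \<epsilon>" using assms(2) by (auto simp: \<delta>_def)
  let ?C = "ennreal (2 / \<epsilon> powr s)"
  have "hausdorff_premeasure s \<delta> Z \<le> hausdorff_measure s Z"
    unfolding hausdorff_measure_def using \<delta> by (intro SUP_upper) auto
  then have small: "hausdorff_premeasure s \<delta> Z < ennreal e" if "0 < e" for e
    using null that by auto
  have "?p Z \<le> ?C * ennreal e" if "0 < e" for e
  proof -
    obtain U :: "nat \<Rightarrow> real set" where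
      "U \<in> {U. Z \<subseteq> (\<Union>i. U i) \<and> (\<forall>i. bounded (U i) \<and> diameter (U i) \<le> \<delta>)}"
      "(\<Sum>i. ennreal (diameter (U i) powr s)) < ennreal e"
      using small[OF \<open>0 < e\<close>] unfolding hausdorff_premeasure_def INF_less_iff by (elim bexE)
    then have U: "Z \<subseteq> (\<Union>i. U i)" "bounded (U i)" "diameter (U i) \<le> \<delta>"
      "(\<Sum>i. ennreal (diameter (U i) powr s)) < ennreal e" for i
      by simp_all
    have "?p Z \<le> ?p (\<Union>i. U i \<inter> {0..1})" using U Z by (intro pressure_premeasure_mono) blast
    also have "\<dots> \<le> (\<Sum>i. ?p (U i \<inter> {0..1}))" by (rule pressure_premeasure_UN_le)
    also have "\<dots> \<le> (\<Sum>i. ?C * ennreal (diameter (U i) powr s))"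
    proof (intro suminf_le summableI)
      fix i
      have diam: "diameter (U i \<inter> {0..1}) \<le> diameter (U i)" using U(2) by (intro diameter_subset) auto
      have "?p (U i \<inter> {0..1}) \<le> ?C * ennreal (diameter (U i \<inter> {0..1}) powr s)"
        using diam U(3)[of i] by (intro pressure_premeasure_small_set_le[OF assms(1-6) \<delta>(2)]) auto
      also have "\<dots> \<le> ?C * ennreal (diameter (U i) powr s)"
        using diam assms(1) bounded_subset[OF U(2)[of i], of "U i \<inter> {0..1}"]
        by (intro mult_left_mono ennreal_leI powr_mono2 diameter_ge_0) auto
      finally show "?p (U i \<inter> {0..1}) \<le> ?C * ennreal (diameter (U i) powr s)" .
    qed
    also have "\<dots> = ?C * (\<Sum>i. ennreal (diameter (U i) powr s))" by (rule ennreal_suminf_cmult)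
    also have "\<dots> \<le> ?C * ennreal e" using U(4) by (intro mult_left_mono) auto
    finally show ?thesis .
  qed
  then have le: "?p Z \<le> ennreal (2 / \<epsilon> powr s * e)" if "0 < e" for e
    using that assms(2) ennreal_mult[of "2 / \<epsilon> powr s" e] by (simp del: ennreal_mult)
  have "?p Z \<le> 0 + ennreal e" if "0 < e" for e
    using le[of "e * \<epsilon> powr s / 2"] that assms(2) by simp
  then have "?p Z \<le> 0" by (rule ennreal_le_epsilon)
  then show ?thesis by simp
qed

lemma eventually_small_scale:
  assumes "0 < \<rho>"
  shows "\<forall>\<^sub>F \<epsilon> in at_right 0. 0 < \<epsilon> \<and> 2 * \<epsilon> \<le> \<rho> \<and> (4 * exp \<Lambda> + 2) * \<epsilon> \<le> mesh"
proof -
  have q: "0 < 4 * exp \<Lambda> + 2" by (simp add: add_pos_pos)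
  then have "0 < min (\<rho> / 2) (mesh / (4 * exp \<Lambda> + 2))" using assms mesh_pos by simp
  with q show ?thesis
    unfolding eventually_at_right_field
    by (intro exI[of _ "min (\<rho> / 2) (mesh / (4 * exp \<Lambda> + 2))"]) (auto simp: field_simps)
qed

lemma eventually_pressure_le:
  assumes "0 < s" "Z \<subseteq> {0..1}" "hausdorff_measure s Z = 0" "0 < \<kappa>"
  shows "\<forall>\<^sub>F \<epsilon> in at_right 0. pressure_at_scale {0..1} f (\<lambda>x. - s * \<psi> x) Z \<epsilon> \<le> ereal \<kappa>"
proof -
  define \<eta> where "\<eta> = \<kappa> / s"
  have \<eta>: "0 < \<eta>" "s * \<eta> = \<kappa>" using assms by (auto simp: \<eta>_def)
  obtain \<rho> where \<rho>: "0 < \<rho>" "distortion_radius \<eta> \<rho>" using distortion_radius_exists[OF \<eta>(1)] .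
  from eventually_small_scale[OF \<rho>(1)] show ?thesis
  proof eventually_elim
    case (elim \<epsilon>)
    then have "pressure_premeasure {0..1} f (\<lambda>x. - s * \<psi> x) Z (s * \<eta>) \<epsilon> N = 0" for N
      by (intro pressure_premeasure_eq_0[OF assms(1) _ \<eta>(1) \<rho>(2) _ _ assms(2,3)]) auto
    then have "pressure_measure {0..1} f (\<lambda>x. - s * \<psi> x) Z (s * \<eta>) \<epsilon> = 0"
      unfolding pressure_measure_eq_SUP by simp
    then show ?case unfolding \<eta>(2) by (rule pressure_at_scale_le)
  qed
qed

lemma psi_multiple_le: "x \<in> {0..1} \<Longrightarrow> - s * \<psi> x \<le> \<bar>s\<bar> * \<Lambda>"
proof -
  assume x: "x \<in> {0..1}"
  have "- s * \<psi> x \<le> \<bar>s\<bar> * \<psi> x" using psi_nonneg[OF x] by (intro mult_right_mono) auto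
  also have "\<dots> \<le> \<bar>s\<bar> * \<Lambda>" using psi_le[OF x] by (intro mult_left_mono) auto
  finally show ?thesis .
qed

lemma eventually_pressure_ge:
  assumes "0 < s" "Z \<subseteq> {0..1}" "hausdorff_measure s Z \<noteq> 0" "0 < \<kappa>"
  shows "\<forall>\<^sub>F \<epsilon> in at_right 0. ereal (- \<kappa>) \<le> pressure_at_scale {0..1} f (\<lambda>x. - s * \<psi> x) Z \<epsilon>"
proof -
  define \<eta> where "\<eta> = \<kappa> / s"
  have \<eta>: "0 < \<eta>" "- s * \<eta> = - \<kappa>" using assms by (auto simp: \<eta>_def)
  obtain \<rho> where \<rho>: "0 < \<rho>" "distortion_radius \<eta> \<rho>" using distortion_radius_exists[OF \<eta>(1)] .
  have "\<exists>\<delta>>0. hausdorff_premeasure s \<delta> Z \<noteq> 0"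
  proof (rule ccontr)
    assume "\<not> ?thesis"
    then have "hausdorff_measure s Z \<le> 0" unfolding hausdorff_measure_def by (intro SUP_least) simp
    with assms(3) show False by simp
  qed
  then obtain \<delta> where \<delta>: "0 < \<delta>" "hausdorff_premeasure s \<delta> Z \<noteq> 0" by blast
  from eventually_small_scale[OF \<rho>(1)] show ?thesis
  proof eventually_elim
    case (elim \<epsilon>)
    then have \<epsilon>: "0 < \<epsilon>" "2 * \<epsilon> \<le> \<rho>" "(4 * exp \<Lambda> + 2) * \<epsilon> \<le> mesh" by auto
    obtain N where N: "\<And>\<Gamma>. \<Gamma> \<in> bowen_covers {0..1} f Z \<epsilon> N \<Longrightarrow>
      hausdorff_premeasure s \<delta> Z \<le> of_nat m * pressure_sum {0..1} f (\<lambda>x. - s * \<psi> x) \<epsilon> (- s * \<eta>) \<Gamma>"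
      using hausdorff_premeasure_le_pressure_sum[OF assms(1) less_imp_le[OF \<eta>(1)] \<rho>(2) \<epsilon>(2,3) \<delta>(1) assms(2)]
      by blast
    have "pressure_premeasure {0..1} f (\<lambda>x. - s * \<psi> x) Z (- s * \<eta>) \<epsilon> N \<noteq> 0"
    proof
      assume "pressure_premeasure {0..1} f (\<lambda>x. - s * \<psi> x) Z (- s * \<eta>) \<epsilon> N = 0"
      then have small: "\<exists>\<Gamma>\<in>bowen_covers {0..1} f Z \<epsilon> N. pressure_sum {0..1} f (\<lambda>x. - s * \<psi> x) \<epsilon> (- s * \<eta>) \<Gamma> < ennreal e"
        if "0 < e" for e
        using that unfolding pressure_premeasure_def INF_less_iff[symmetric] by simp
      have "hausdorff_premeasure s \<delta> Z \<le> 0 + ennreal e" if "0 < e" for e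
      proof -
        obtain \<Gamma> where \<Gamma>: "\<Gamma> \<in> bowen_covers {0..1} f Z \<epsilon> N"
          "pressure_sum {0..1} f (\<lambda>x. - s * \<psi> x) \<epsilon> (- s * \<eta>) \<Gamma> < ennreal (e / m)"
          using small[of "e / m"] \<open>0 < e\<close> m_pos by auto
        have "hausdorff_premeasure s \<delta> Z \<le> of_nat m * ennreal (e / m)"
          using \<Gamma>(2) by (intro order_trans[OF N[OF \<Gamma>(1)]] mult_left_mono) auto
        also have "\<dots> = ennreal e" using m_pos \<open>0 < e\<close> by (simp add: ennreal_of_nat_eq_real_of_nat flip: ennreal_mult)
        finally show ?thesis by simp
      qed
      then have "hausdorff_premeasure s \<delta> Z \<le> 0" by (rule ennreal_le_epsilon)
      with \<delta>(2) show False by simp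
    qed
    then have "pressure_measure {0..1} f (\<lambda>x. - s * \<psi> x) Z (- s * \<eta>) \<epsilon> \<noteq> 0"
      using SUP_upper[of N UNIV "pressure_premeasure {0..1} f (\<lambda>x. - s * \<psi> x) Z (- s * \<eta>) \<epsilon>"]
      unfolding pressure_measure_eq_SUP by auto
    then show ?case
      using elim \<eta>(2) by (intro pressure_at_scale_ge[OF f_maps _ psi_multiple_le]) auto
  qed
qed

lemma pressure_at_scale_antimono:
  assumes "s \<le> s'" "0 < \<epsilon>"
  shows "pressure_at_scale {0..1} f (\<lambda>x. - s' * \<psi> x) Z \<epsilon> \<le> pressure_at_scale {0..1} f (\<lambda>x. - s * \<psi> x) Z \<epsilon>"
proof -
  have "- s' * \<psi> x \<le> - s * \<psi> x + 0" if "x \<in> {0..1}" for x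
    using assms(1) psi_nonneg[OF that] by (simp add: mult_right_mono)
  from pressure_at_scale_mono_add[OF f_maps assms(2) psi_multiple_le this] show ?thesis by simp
qed

lemma pressure_at_scale_lipschitz:
  assumes "s \<le> s'" "0 < \<epsilon>"
  shows "pressure_at_scale {0..1} f (\<lambda>x. - s * \<psi> x) Z \<epsilon>
    \<le> pressure_at_scale {0..1} f (\<lambda>x. - s' * \<psi> x) Z \<epsilon> + ereal ((s' - s) * \<Lambda>)"
proof -
  have "- s * \<psi> x \<le> - s' * \<psi> x + (s' - s) * \<Lambda>" if "x \<in> {0..1}" for x
    using mult_left_mono[OF psi_le[OF that], of "s' - s"] assms(1) by (simp add: algebra_simps)
  from pressure_at_scale_mono_add[OF f_maps assms(2) psi_multiple_le this] show ?thesis .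
qed

text \<open>For \<open>s = 0\<close> and \<open>r = 0\<close> every ball has weight \<open>1\<close>, and a nonempty set needs at least one ball.\<close>

lemma pressure_at_scale_0_nonneg:
  assumes "Z \<noteq> {}" "0 < \<epsilon>"
  shows "0 \<le> pressure_at_scale {0..1} f (\<lambda>x. - 0 * \<psi> x) Z \<epsilon>"
proof -
  have "1 \<le> pressure_sum {0..1} f (\<lambda>x. - 0 * \<psi> x) \<epsilon> 0 \<Gamma>" if \<Gamma>: "\<Gamma> \<in> bowen_covers {0..1} f Z \<epsilon> 0" for \<Gamma>
  proof -
    obtain x n where xn: "(x, n) \<in> \<Gamma>" "x \<in> {0..1}" using assms(1) \<Gamma> by (fastforce simp: bowen_covers_def)
    have "bowen_ball {0..1} f n x \<epsilon> \<noteq> {}" using centre_in_bowen_ball[OF xn(2) assms(2)] by blast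
    then show ?thesis
      unfolding pressure_sum_def
      using sum_le_infsum_ennreal[of "{(x, n)}" \<Gamma> "\<lambda>(x, n). ennreal (exp (- 0 * real n
        + (SUP y\<in>bowen_ball {0..1} f n x \<epsilon>. \<Sum>k<n. - 0 * \<psi> ((f ^^ k) y))))"] xn(1) by simp
  qed
  then have "1 \<le> pressure_premeasure {0..1} f (\<lambda>x. - 0 * \<psi> x) Z 0 \<epsilon> 0"
    unfolding pressure_premeasure_def by (intro INF_greatest)
  also have "\<dots> \<le> pressure_measure {0..1} f (\<lambda>x. - 0 * \<psi> x) Z 0 \<epsilon>"
    unfolding pressure_measure_eq_SUP by (rule SUP_upper) simp
  finally have "pressure_measure {0..1} f (\<lambda>x. - 0 * \<psi> x) Z 0 \<epsilon> \<noteq> 0" by auto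
  from pressure_at_scale_ge[OF f_maps assms(2) psi_multiple_le this] show ?thesis by (simp add: zero_ereal_def)
qed

end

section \<open>Piecewise smooth Markov maps\<close>

lemma uniform_positive_constant:
  fixes m :: nat
  assumes "\<And>i. i < m \<Longrightarrow> \<exists>c>0::real. Q i c" and "\<And>i c c'. Q i c \<Longrightarrow> c' \<le> c \<Longrightarrow> Q i c'"
  shows "\<exists>c>0. \<forall>i<m. Q i c"
  using assms(1)
proof (induction m)
  case (Suc m)
  obtain c where "0 < c" "\<forall>i<m. Q i c" using Suc.IH Suc.prems by auto
  moreover obtain c' where "0 < c'" "Q m c'" using Suc.prems[of m] by auto
  ultimately show ?case
    using assms(2)[of _ c "min c c'"] assms(2)[of m c' "min c c'"]
    by (intro exI[of _ "min c c'"]) (simp add: less_Suc_eq all_conj_distrib)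
qed (auto intro: exI[of _ 1])

text \<open>By compactness the gain \<open>g (u + \<delta>) - g u - \<delta>\<close> has a positive minimum, and enlarging an interval
  cannot decrease the gain.\<close>

lemma branch_growth:
  fixes g :: "real \<Rightarrow> real"
  assumes cont: "continuous_on {l..r} g" and "0 < \<delta>"
    and strict: "\<And>u v. l \<le> u \<Longrightarrow> u < v \<Longrightarrow> v \<le> r \<Longrightarrow> v - u < g v - g u"
  shows "\<exists>c>0. \<forall>u v. l \<le> u \<longrightarrow> u + \<delta> \<le> v \<longrightarrow> v \<le> r \<longrightarrow> v - u + c \<le> g v - g u"
proof (cases "l \<le> r - \<delta>")
  case True
  have "continuous_on {l..r - \<delta>} (\<lambda>t. g (t + \<delta>) - g t)"
    using \<open>0 < \<delta>\<close> by (intro continuous_intros continuous_on_compose2[OF cont]) auto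
  then obtain t where t: "t \<in> {l..r - \<delta>}" "\<And>u. u \<in> {l..r - \<delta>} \<Longrightarrow> g (t + \<delta>) - g t \<le> g (u + \<delta>) - g u"
    using continuous_attains_inf[of "{l..r - \<delta>}" "\<lambda>t. g (t + \<delta>) - g t"] True by auto
  define c where "c = g (t + \<delta>) - g t - \<delta>"
  have "0 < c" using strict[of t "t + \<delta>"] t(1) \<open>0 < \<delta>\<close> by (auto simp: c_def)
  moreover have "v - u + c \<le> g v - g u" if "l \<le> u" "u + \<delta> \<le> v" "v \<le> r" for u v
    using t(2)[of u] that strict[of "u + \<delta>" v] \<open>0 < \<delta>\<close> by (cases "u + \<delta> = v") (auto simp: c_def)
  ultimately show ?thesis by blast
next
  case False
  then show ?thesis by (intro exI[of _ 1]) auto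
qed
text \<open>The finitely many points with derivative \<open>1\<close> do not spoil strict expansion: between any two points of a
  branch there is one with derivative larger than \<open>1\<close>, so the growth constants are positive by
  \<open>branch_growth\<close>. Taking closures, the Markov property says that the ends of the image of a
  branch are partition points.\<close>

lemma markov_map_expanding_branches:
  assumes f_maps: "f \<in> {0..1} \<rightarrow> {0..1}" and markov: "piecewise_C1_Markov f Df" and fin: "finite P"
    and Df_ge: "\<And>x. x \<in> {0..1} \<Longrightarrow> 1 \<le> Df x" and Df_gt: "\<And>x. x \<in> {0..1} - P \<Longrightarrow> 1 < Df x"
  obtains m a g \<Lambda> where "expanding_branches m a f (\<lambda>x. ln (Df x)) g \<Lambda>"
proof -
  obtain m a g g' where M: "0 < (m::nat)" "a 0 = 0" "a m = 1" "\<forall>i<m. a i < a (Suc i)"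
    and branches: "\<forall>i<m.
        strict_mono_on {a i<..<a (Suc i)} f \<and>
        (\<forall>x\<in>{a i..a (Suc i)}. (g i has_real_derivative g' i x) (at x within {a i..a (Suc i)})) \<and>
        continuous_on {a i..a (Suc i)} (g' i) \<and>
        (\<forall>x\<in>{a i<..<a (Suc i)}. f x = g i x \<and> Df x = g' i x) \<and>
        (\<exists>J\<subseteq>{..<m}. closure (f ` {a i<..<a (Suc i)}) = (\<Union>j\<in>J. {a j..a (Suc j)}))"
    and partition_points: "\<forall>k\<le>m. \<exists>i<m. (k = i \<or> k = Suc i) \<and> f (a k) = g i (a k) \<and> Df (a k) = g' i (a k)"
    using markov unfolding piecewise_C1_Markov_def by (elim exE conjE) (rule that)
  have deriv: "(g i has_real_derivative g' i x) (at x within {a i..a (Suc i)})"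
    if "i < m" "x \<in> {a i..a (Suc i)}" for i x using branches that by blast
  have g'_cont: "continuous_on {a i..a (Suc i)} (g' i)" if "i < m" for i using branches that by blast
  have inside: "f x = g i x \<and> Df x = g' i x" if "i < m" "x \<in> {a i<..<a (Suc i)}" for i x
    using branches that by blast
  have image: "\<exists>J\<subseteq>{..<m}. closure (f ` {a i<..<a (Suc i)}) = (\<Union>j\<in>J. {a j..a (Suc j)})" if "i < m" for i
    using branches that by blast
  have ends: "\<exists>i<m. (k = i \<or> k = Suc i) \<and> f (a k) = g i (a k) \<and> Df (a k) = g' i (a k)" if "k \<le> m" for k
    using partition_points that by blast
  interpret unit_partition m a using M by unfold_locales auto
  have in_unit: "x \<in> {0..1}" if "i < m" "x \<in> {a i..a (Suc i)}" for i x
    using branch_subset[OF that(1)] that(2) by blast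
  have g_cont: "continuous_on {a i..a (Suc i)} (g i)" if "i < m" for i
    using deriv[OF that] by (intro DERIV_continuous_on) blast
  have mvt: "\<exists>\<xi>\<in>{u<..<v}. g i v - g i u = Df \<xi> * (v - u)"
    if "i < m" "a i \<le> u" "u < v" "v \<le> a (Suc i)" for i u v
  proof -
    have "(g i has_derivative (*) (g' i x)) (at x within {u..v})" if "u \<le> x" "x \<le> v" for x
      by (rule has_derivative_subset[OF deriv[OF \<open>i < m\<close>, of x, unfolded has_field_derivative_def]])
        (use that \<open>a i \<le> u\<close> \<open>v \<le> a (Suc i)\<close> in auto)
    then obtain \<xi> where "\<xi> \<in> {u<..<v}" "g i v - g i u = g' i \<xi> * (v - u)"
      using mvt_simple[OF \<open>u < v\<close>, of "g i" "\<lambda>x. (*) (g' i x)"] by blast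
    then show ?thesis using inside[of i \<xi>] that by (intro bexI[of _ \<xi>]) auto
  qed
  have expand: "v - u \<le> g i v - g i u" if "i < m" "a i \<le> u" "u \<le> v" "v \<le> a (Suc i)" for i u v
  proof (cases "u = v")
    case False
    then obtain \<xi> where \<xi>: "\<xi> \<in> {u<..<v}" "g i v - g i u = Df \<xi> * (v - u)"
      using mvt[of i u v] \<open>i < m\<close> \<open>a i \<le> u\<close> \<open>u \<le> v\<close> \<open>v \<le> a (Suc i)\<close> by auto
    have "\<xi> \<in> {0..1}" using \<xi>(1) that by (intro in_unit[of i]) auto
    from mult_right_mono[OF Df_ge[OF this], of "v - u"] show ?thesis using \<xi>(2) that by simp
  qed simp
  have strict: "v - u < g i v - g i u" if uv: "i < m" "a i \<le> u" "u < v" "v \<le> a (Suc i)" for i u v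
  proof -
    \<comment> \<open>Strictness comes from a small interval \<open>[w, w + h]\<close> at a point \<open>w\<close> with derivative larger than \<open>1\<close>.\<close>
    have "infinite ({u<..<v} - P)" using fin \<open>u < v\<close> by (intro Diff_infinite_finite) auto
    then obtain w where w: "w \<in> {u<..<v}" "w \<notin> P" using infinite_imp_nonempty by blast
    have "w \<in> {a i<..<a (Suc i)}" using w uv by auto
    then have "(g i has_real_derivative g' i w) (at w)"
      using deriv[OF uv(1), of w] by (simp add: at_within_Icc_at)
    then have D: "((\<lambda>x. g i x - x) has_real_derivative g' i w - 1) (at w)"
      by (auto intro!: derivative_eq_intros)
    have "1 < g' i w"
      using Df_gt[of w] in_unit[of i w] inside[of i w] w uv \<open>w \<in> {a i<..<a (Suc i)}\<close> by auto
    then obtain d where d: "0 < d" "\<And>h. 0 < h \<Longrightarrow> h < d \<Longrightarrow> g i w - w < g i (w + h) - (w + h)"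
      using DERIV_pos_inc_right[OF D] by auto
    define h where "h = min (d / 2) ((v - w) / 2)"
    have h: "0 < h" "h < d" "w + h \<le> v" using d(1) w by (auto simp: h_def min_def field_simps)
    show ?thesis
      using d(2)[OF h(1,2)] expand[of i u w] expand[of i "w + h" v] h w uv by auto
  qed
  have bounds: "g i (a i) \<in> a ` {..m}" "g i (a (Suc i)) \<in> a ` {..m}" if i: "i < m" for i
  proof -
    let ?l = "g i (a i)" and ?r = "g i (a (Suc i))"
    have lr: "?l < ?r" using strict[OF i order_refl a_less[OF i] order_refl] a_less[OF i] by simp
    have "f ` {a i<..<a (Suc i)} = {?l<..<?r}"
    proof
      show "f ` {a i<..<a (Suc i)} \<subseteq> {?l<..<?r}"
      proof (intro subsetI, elim imageE)
        fix y x assume x: "x \<in> {a i<..<a (Suc i)}" "y = f x"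
        then show "y \<in> {?l<..<?r}"
          using strict[of i "a i" x] strict[of i x "a (Suc i)"] inside[OF i x(1)] i by auto
      qed
      show "{?l<..<?r} \<subseteq> f ` {a i<..<a (Suc i)}"
      proof
        fix y assume y: "y \<in> {?l<..<?r}"
        then obtain x where x: "a i \<le> x" "x \<le> a (Suc i)" "g i x = y"
          using IVT'[of "g i" "a i" y "a (Suc i)"] g_cont[OF i] a_less[OF i] by auto
        then have "x \<in> {a i<..<a (Suc i)}" using y by (auto simp: less_le)
        then show "y \<in> f ` {a i<..<a (Suc i)}" using x(3) inside[OF i] by force
      qed
    qed
    then obtain J where J: "J \<subseteq> {..<m}" "{?l..?r} = (\<Union>j\<in>J. {a j..a (Suc j)})"
      using image[OF i] lr by (auto simp: closure_greaterThanLessThan)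
    have "?l \<in> {?l..?r}" "?r \<in> {?l..?r}" using lr by auto
    then obtain j j' where j: "j \<in> J" "?l \<in> {a j..a (Suc j)}" and j': "j' \<in> J" "?r \<in> {a j'..a (Suc j')}"
      unfolding J(2) by blast
    have jm: "j < m" "j' < m" using j j' J(1) by auto
    then have "a j \<in> {a j..a (Suc j)}" "a (Suc j') \<in> {a j'..a (Suc j')}"
      using a_less[of j] a_less[of j'] by auto
    then have "a j \<in> {?l..?r}" "a (Suc j') \<in> {?l..?r}"
      unfolding J(2) using j(1) j'(1) by blast+
    then have "?l = a j" "?r = a (Suc j')" using j j' by auto
    then show "?l \<in> a ` {..m}" "?r \<in> a ` {..m}" using jm by auto
  qed
  have "\<exists>L. \<forall>x\<in>{0..1}. Df x \<le> L"
  proof -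
    have "compact (\<Union>i<m. g' i ` {a i..a (Suc i)})"
      using g'_cont by (intro compact_UN compact_continuous_image) auto
    then obtain L where L: "\<And>y. y \<in> (\<Union>i<m. g' i ` {a i..a (Suc i)}) \<Longrightarrow> norm y \<le> L"
      using compact_imp_bounded bounded_iff by metis
    have "Df x \<le> L" if x: "x \<in> {0..1}" for x
    proof -
      have "\<exists>i<m. x \<in> {a i..a (Suc i)} \<and> Df x = g' i x"
      proof (cases "x \<in> a ` {..m}")
        case True
        then obtain k where k: "k \<le> m" "x = a k" by auto
        obtain i where "i < m" "k = i \<or> k = Suc i" "Df (a k) = g' i (a k)" using ends[OF k(1)] by blast
        then show ?thesis using k(2) a_less[of i] by (intro exI[of _ i]) auto
      next
        case False
        then obtain i where i: "i < m" "x \<in> {a i<..<a (Suc i)}" using branch_exists x by blast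
        then show ?thesis using inside[OF i] by (intro exI[of _ i]) auto
      qed
      then obtain i where "i < m" "x \<in> {a i..a (Suc i)}" "Df x = g' i x" by blast
      then have "Df x \<in> (\<Union>i<m. g' i ` {a i..a (Suc i)})" by blast
      from L[OF this] show ?thesis by simp
    qed
    then show ?thesis by blast
  qed
  then obtain L where L: "\<And>x. x \<in> {0..1} \<Longrightarrow> Df x \<le> L" by blast
  have "expanding_branches m a f (\<lambda>x. ln (Df x)) g (ln L)"
  proof
    fix i u v
    assume "i < m" "a i \<le> u" "u < v" "v \<le> a (Suc i)"
    moreover from this obtain \<xi> where \<xi>: "\<xi> \<in> {u<..<v}" "g i v - g i u = Df \<xi> * (v - u)" using mvt by blast
    moreover have "\<xi> \<in> {0..1}" by (rule in_unit[of i]) (use calculation in auto)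
    ultimately show "\<exists>\<xi>\<in>{u<..<v}. g i v - g i u = exp (ln (Df \<xi>)) * (v - u)"
      using Df_ge[of \<xi>] by (intro bexI[of _ \<xi>]) auto
  next
    fix \<eta> :: real assume "0 < \<eta>"
    have "\<exists>\<rho>>0. \<forall>i<m. \<forall>x\<in>{a i..a (Suc i)}. \<forall>y\<in>{a i..a (Suc i)}. dist y x < \<rho> \<longrightarrow> dist (g' i y) (g' i x) < \<eta>"
    proof (rule uniform_positive_constant)
      fix i assume "i < m"
      have "uniformly_continuous_on {a i..a (Suc i)} (g' i)"
        by (rule compact_uniformly_continuous[OF g'_cont[OF \<open>i < m\<close>]]) simp
      then show "\<exists>\<rho>>0. \<forall>x\<in>{a i..a (Suc i)}. \<forall>y\<in>{a i..a (Suc i)}. dist y x < \<rho> \<longrightarrow> dist (g' i y) (g' i x) < \<eta>"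
        using \<open>0 < \<eta>\<close> unfolding uniformly_continuous_on_def by blast
    qed force
    then obtain \<rho> where \<rho>: "0 < \<rho>" "\<And>i x y. i < m \<Longrightarrow> x \<in> {a i..a (Suc i)} \<Longrightarrow> y \<in> {a i..a (Suc i)}
        \<Longrightarrow> dist y x < \<rho> \<Longrightarrow> dist (g' i y) (g' i x) < \<eta>" by blast
    have ln_lip: "\<bar>ln s - ln t\<bar> \<le> \<bar>s - t\<bar>" if "1 \<le> s" "1 \<le> t" for s t :: real
    proof -
      have "ln s - ln t \<le> s - t" if "1 \<le> t" "t \<le> s" for s t :: real
      proof -
        have "ln s - ln t \<le> (s - t) / t" using that ln_diff_le[of s t] by simp
        also have "\<dots> \<le> (s - t) / 1" using that by (intro divide_left_mono) auto
        finally show ?thesis by simp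
      qed
      from this[of s t] this[of t s] that show ?thesis
        using ln_le_cancel_iff[of s t] ln_le_cancel_iff[of t s] by (cases "s \<le> t") (auto simp: abs_real_def)
    qed
    have "\<bar>ln (Df x) - ln (Df y)\<bar> \<le> \<eta>"
      if "i < m" "x \<in> {a i<..<a (Suc i)}" "y \<in> {a i<..<a (Suc i)}" "\<bar>x - y\<bar> < \<rho>" for i x y
    proof -
      have "\<bar>Df x - Df y\<bar> \<le> \<eta>"
        using \<rho>(2)[of i y x] inside[of i] that by (force simp: dist_real_def)
      moreover have "1 \<le> Df x" "1 \<le> Df y" using that by (auto intro!: Df_ge in_unit[of i])
      ultimately show ?thesis using ln_lip[of "Df x" "Df y"] by simp
    qed
    then show "\<exists>\<rho>>0. \<forall>i<m. \<forall>x\<in>{a i<..<a (Suc i)}. \<forall>y\<in>{a i<..<a (Suc i)}.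
      \<bar>x - y\<bar> < \<rho> \<longrightarrow> \<bar>ln (Df x) - ln (Df y)\<bar> \<le> \<eta>"
      using \<rho>(1) by blast
  next
    fix \<delta> :: real assume "0 < \<delta>"
    show "\<exists>c>0. \<forall>i<m. \<forall>u v. a i \<le> u \<longrightarrow> u + \<delta> \<le> v \<longrightarrow> v \<le> a (Suc i) \<longrightarrow> v - u + c \<le> g i v - g i u"
    proof (rule uniform_positive_constant)
      fix i assume "i < m"
      show "\<exists>c>0. \<forall>u v. a i \<le> u \<longrightarrow> u + \<delta> \<le> v \<longrightarrow> v \<le> a (Suc i) \<longrightarrow> v - u + c \<le> g i v - g i u"
        using g_cont[OF \<open>i < m\<close>] \<open>0 < \<delta>\<close> strict[OF \<open>i < m\<close>] by (rule branch_growth)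
    qed force
  next
    fix k assume "k \<le> m"
    then obtain i where "i < m" "k = i \<or> k = Suc i" "f (a k) = g i (a k)" using ends by blast
    then show "f (a k) \<in> a ` {..m}" using bounds[of i] by auto
  next
    fix x :: real assume x: "x \<in> {0..1}"
    show "0 \<le> ln (Df x)" "ln (Df x) \<le> ln L" using Df_ge[OF x] L[OF x] by auto
  qed (use f_maps inside g_cont bounds in auto)
  then show ?thesis by (rule that)
qed

section \<open>The zero of the pressure\<close>

lemma ereal_tendsto_0I:
  fixes h :: "'i \<Rightarrow> ereal"
  assumes "\<And>\<kappa>. 0 < \<kappa> \<Longrightarrow> \<forall>\<^sub>F x in F. ereal (- \<kappa>) \<le> h x" "\<And>\<kappa>. 0 < \<kappa> \<Longrightarrow> \<forall>\<^sub>F x in F. h x \<le> ereal \<kappa>"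
  shows "(h \<longlongrightarrow> 0) F"
proof (rule order_tendstoI)
  fix l :: ereal assume "l < 0"
  then obtain r where r: "l < ereal r" "ereal r < 0" using ereal_dense2 by blast
  show "\<forall>\<^sub>F x in F. l < h x"
    using assms(1)[of "- r"] r by (auto elim!: eventually_mono)
next
  fix l :: ereal assume "0 < l"
  then obtain r where r: "0 < ereal r" "ereal r < l" using ereal_dense2 by blast
  show "\<forall>\<^sub>F x in F. h x < l"
    using assms(2)[of r] r by (auto elim!: eventually_mono)
qed

text \<open>\<open>Lim\<close> is a definite description, so it has the same value at any two parameters without a limit.
  If \<open>d\<close> had no limit, then every other parameter would have one, since otherwise it would be a zero like \<open>d\<close>.
  By the Lipschitz condition \<open>p d\<close> is uniformly approximated by functions with limits,
  and so has a limit itself.\<close>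

lemma tendsto_at_unique_zero_of_Lim:
  fixes p :: "real \<Rightarrow> 'i \<Rightarrow> ereal"
  assumes F: "F \<noteq> bot"
    and unique: "\<And>s. Lim F (p s) = 0 \<longleftrightarrow> s = d"
    and mono: "\<And>s s'. s \<le> s' \<Longrightarrow> \<forall>\<^sub>F x in F. p s' x \<le> p s x"
    and lipschitz: "\<And>s s'. s \<le> s' \<Longrightarrow> \<forall>\<^sub>F x in F. p s x \<le> p s' x + ereal ((s' - s) * \<Lambda>)"
  shows "(p d \<longlongrightarrow> 0) F"
proof -
  have "\<exists>l. (p d \<longlongrightarrow> l) F"
  proof (rule ccontr)
    assume none: "\<nexists>l. (p d \<longlongrightarrow> l) F"
    have ex: "\<exists>l. (p s \<longlongrightarrow> l) F" if "s \<noteq> d" for s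
    proof (rule ccontr)
      assume "\<nexists>l. (p s \<longlongrightarrow> l) F"
      with none have "Lim F (p s) = Lim F (p d)" by (simp add: t2_space_class.Lim_def)
      with unique[of d] unique[of s] that show False by simp
    qed
    have "Limsup F (p d) \<le> Liminf F (p d)"
    proof (rule ereal_le_epsilon2)
      fix e :: real assume "0 < e"
      \<comment> \<open>a step in \<open>s\<close> that changes \<open>p\<close> by at most \<open>e\<close>; the summand \<open>1\<close> only avoids division by zero\<close>
      define t where "t = e / (\<bar>\<Lambda>\<bar> + 1)"
      have t: "0 < t" "t * \<Lambda> \<le> e"
      proof -
        show "0 < t" using \<open>0 < e\<close> by (simp add: t_def)
        have "t * \<Lambda> \<le> t * (\<bar>\<Lambda>\<bar> + 1)" using \<open>0 < t\<close> by (intro mult_left_mono) auto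
        then show "t * \<Lambda> \<le> e" by (simp add: t_def)
      qed
      obtain l where l: "(p (d + t) \<longlongrightarrow> l) F" using ex[of "d + t"] t(1) by auto
      have lims: "Liminf F (p (d + t)) = l" "Limsup F (p (d + t)) = l"
        using lim_imp_Liminf[OF F l] lim_imp_Limsup[OF F l] by auto
      have "Limsup F (p d) \<le> Limsup F (\<lambda>x. p (d + t) x + ereal (t * \<Lambda>))"
        using lipschitz[of d "d + t"] t(1) by (intro Limsup_mono) simp
      also have "\<dots> = l + ereal (t * \<Lambda>)"
        using F lims by (subst Limsup_add_ereal_right) auto
      also have "l \<le> Liminf F (p d)"
        unfolding lims(1)[symmetric] using mono[of d "d + t"] t(1) by (intro Liminf_mono) simp
      finally show "Limsup F (p d) \<le> Liminf F (p d) + ereal e"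
        using t(2) by (meson add_mono ereal_less_eq(3) order_refl order_trans)
    qed
    then have "Liminf F (p d) = Limsup F (p d)" using Liminf_le_Limsup[OF F, of "p d"] by simp
    then have "(p d \<longlongrightarrow> Limsup F (p d)) F" using F by (intro Liminf_eq_Limsup) auto
    with none show False by blast
  qed
  then obtain l where l: "(p d \<longlongrightarrow> l) F" by blast
  moreover have "l = 0" using tendsto_Lim[OF F l] unique[of d] by simp
  ultimately show ?thesis by simp
qed

theorem theorem7:
  fixes f Df \<phi> \<psi> :: "real \<Rightarrow> real" and \<alpha> d :: real and P :: "real set"
  assumes f_maps: "f \<in> {0..1} \<rightarrow> {0..1}"
    and markov: "piecewise_C1_Markov f Df"
    and spec: "specification_property {0..1} f"
    and fin: "finite P"
    and parabolic: "\<forall>x\<in>P. x \<in> {0..1} \<and> f x = x \<and> Df x = 1"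
    and expanding: "\<forall>x\<in>{0..1} - P. Df x > 1"
    and psi: "\<psi> = (\<lambda>x. ln (Df x))"
    and cont: "continuous_on {0..1} \<phi>"
    and nonempty: "birkhoff_level_set {0..1} f \<phi> \<alpha> \<noteq> {}"
    and unique_zero:
      "\<forall>s::real. topological_pressure {0..1} f (birkhoff_level_set {0..1} f \<phi> \<alpha>) (\<lambda>x. - s * \<psi> x) = 0
         \<longleftrightarrow> s = d"
    and dim_formula:
      "hausdorff_dim (birkhoff_level_set {0..1} f \<phi> \<alpha>) =
         Sup {measure_entropy \<mu> f / ereal (\<integral>x. ln (Df x) \<partial>\<mu>) | \<mu>.
               \<mu> \<in> invariant_prob_measures {0..1} f \<and> (\<integral>x. \<phi> x \<partial>\<mu>) = \<alpha> \<and> 0 < (\<integral>x. ln (Df x) \<partial>\<mu>)}"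
  shows "ereal d = hausdorff_dim (birkhoff_level_set {0..1} f \<phi> \<alpha>)"
proof -
  define Z where "Z = birkhoff_level_set {0..1} f \<phi> \<alpha>"
  have Z: "Z \<subseteq> {0..1}" "Z \<noteq> {}" using nonempty by (auto simp: Z_def birkhoff_level_set_def)
  have "1 \<le> Df x" if "x \<in> {0..1}" for x
    using expanding parabolic that by (cases "x \<in> P") (auto intro: less_imp_le)
  then obtain m a g \<Lambda> where "expanding_branches m a f (\<lambda>x. ln (Df x)) g \<Lambda>"
    using markov_map_expanding_branches[OF f_maps markov fin] expanding by blast
  then interpret expanding_branches m a f \<psi> g \<Lambda> by (simp add: psi)
  define p where "p s \<epsilon> = pressure_at_scale {0..1} f (\<lambda>x. - s * \<psi> x) Z \<epsilon>" for s \<epsilon>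
  have pos: "\<forall>\<^sub>F \<epsilon> in at_right (0::real). 0 < \<epsilon>" by (simp add: eventually_at_right_less)
  have anti: "\<forall>\<^sub>F \<epsilon> in at_right 0. p s' \<epsilon> \<le> p s \<epsilon>" if "s \<le> s'" for s s'
    using pos by eventually_elim (unfold p_def, rule pressure_at_scale_antimono[OF that])
  have unique: "Lim (at_right 0) (p s) = 0 \<longleftrightarrow> s = d" for s
    using unique_zero unfolding topological_pressure_def p_def[abs_def] Z_def by blast
  have zero_at: "s = d" if "(p s \<longlongrightarrow> 0) (at_right 0)" for s
    using tendsto_Lim[OF trivial_limit_at_right_real that] unique by simp
  have pd: "(p d \<longlongrightarrow> 0) (at_right 0)"
  proof (rule tendsto_at_unique_zero_of_Lim[OF trivial_limit_at_right_real unique anti])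
    fix s s' :: real assume "s \<le> s'"
    from pos show "\<forall>\<^sub>F \<epsilon> in at_right 0. p s \<epsilon> \<le> p s' \<epsilon> + ereal ((s' - s) * \<Lambda>)"
      by eventually_elim (unfold p_def, rule pressure_at_scale_lipschitz[OF \<open>s \<le> s'\<close>])
  qed
  have pd_ge: "\<forall>\<^sub>F \<epsilon> in at_right 0. ereal (- \<kappa>) \<le> p d \<epsilon>" if "0 < \<kappa>" for \<kappa>
    by (rule eventually_mono[OF order_tendstoD(1)[OF pd, of "ereal (- \<kappa>)"]]) (use that in auto)
  have pd_le: "\<forall>\<^sub>F \<epsilon> in at_right 0. p d \<epsilon> \<le> ereal \<kappa>" if "0 < \<kappa>" for \<kappa>
    by (rule eventually_mono[OF order_tendstoD(2)[OF pd, of "ereal \<kappa>"]]) (use that in auto)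
  \<comment> \<open>By monotonicity \<open>p d\<close> bounds \<open>p s\<close> on one side, so a bound on the other side makes \<open>s\<close> a zero.\<close>
  have above: "s = d" if "d \<le> s" "\<And>\<kappa>. 0 < \<kappa> \<Longrightarrow> \<forall>\<^sub>F \<epsilon> in at_right 0. ereal (- \<kappa>) \<le> p s \<epsilon>" for s
  proof (rule zero_at, rule ereal_tendsto_0I[OF that(2)])
    fix \<kappa> :: real assume "0 < \<kappa>"
    from pd_le[OF this] anti[OF that(1)] show "\<forall>\<^sub>F \<epsilon> in at_right 0. p s \<epsilon> \<le> ereal \<kappa>"
      by eventually_elim (rule order_trans)
  qed
  have below: "s = d" if "s \<le> d" "\<And>\<kappa>. 0 < \<kappa> \<Longrightarrow> \<forall>\<^sub>F \<epsilon> in at_right 0. p s \<epsilon> \<le> ereal \<kappa>" for s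
  proof (rule zero_at, rule ereal_tendsto_0I[OF _ that(2)])
    fix \<kappa> :: real assume "0 < \<kappa>"
    from pd_ge[OF this] anti[OF that(1)] show "\<forall>\<^sub>F \<epsilon> in at_right 0. ereal (- \<kappa>) \<le> p s \<epsilon>"
      by eventually_elim (rule order_trans)
  qed
  have "0 \<le> d"
  proof (rule ccontr)
    assume "\<not> 0 \<le> d"
    moreover have "0 = d"
    proof (rule above)
      fix \<kappa> :: real assume "0 < \<kappa>"
      from pos show "\<forall>\<^sub>F \<epsilon> in at_right 0. ereal (- \<kappa>) \<le> p 0 \<epsilon>"
      proof eventually_elim
        case (elim \<epsilon>)
        then have "0 \<le> p 0 \<epsilon>" unfolding p_def by (rule pressure_at_scale_0_nonneg[OF Z(2)])
        moreover have "ereal (- \<kappa>) \<le> 0" using \<open>0 < \<kappa>\<close> by simp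
        ultimately show ?case by (rule order_trans[rotated])
      qed
    qed (use calculation in simp)
    ultimately show False by simp
  qed
  have "hausdorff_dim Z \<le> ereal d"
  proof (rule ccontr)
    assume "\<not> hausdorff_dim Z \<le> ereal d"
    then obtain s where s: "d < s" "ereal s < hausdorff_dim Z"
      using ereal_dense2[of "ereal d" "hausdorff_dim Z"] by (auto simp: not_le)
    then have "0 < s" using \<open>0 \<le> d\<close> by simp
    have "hausdorff_measure s Z \<noteq> 0"
    proof
      assume "hausdorff_measure s Z = 0"
      then have "hausdorff_dim Z \<le> ereal s"
        unfolding hausdorff_dim_def using \<open>0 < s\<close> by (intro Inf_lower) auto
      with s(2) show False by simp
    qed
    then have "s = d"
      using s(1) eventually_pressure_ge[OF \<open>0 < s\<close> Z(1)] by (intro above) (auto simp: p_def)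
    with s(1) show False by simp
  qed
  moreover have "ereal d \<le> hausdorff_dim Z"
  proof (rule ccontr)
    assume "\<not> ereal d \<le> hausdorff_dim Z"
    then obtain s where s: "0 < s" "hausdorff_measure s Z = 0" "s < d"
      unfolding hausdorff_dim_def not_le Inf_less_iff by auto
    then have "s = d"
      using eventually_pressure_le[OF s(1) Z(1) s(2)] by (intro below) (auto simp: p_def)
    with s(3) show False by simp
  qed
  ultimately show ?thesis unfolding Z_def by (rule antisym[rotated])
qed

end
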